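(* Let $\chi=\{(M_1,N_1,d_1),\dots,(M_K,N_K,d_K)\}$ be the configuration of a MIMO interference network. Almost surely with respect to the random channel matrices, if the interference alignment (IA) problem for $\chi$ has a solution, then all of the following hold: (i) $\min\{M_j,N_j\}\ge d_j$ for all $j\in\{1,\dots,K\}$; (ii) for every $\mathcal{J}_{\mathrm{sub}}\subseteq\mathcal{J}$, $$\max\Big\{\sum_{j\in T(\mathcal{J}_{\mathrm{sub}})}M_j,\ \sum_{k\in R(\mathcal{J}_{\mathrm{sub}})}N_k\Big\}\ \ge\ \sum_{j\in T(\mathcal{J}_{\mathrm{sub}})\cup R(\mathcal{J}_{\mathrm{sub}})}d_j;$$ (iii) for every $\mathcal{J}_{\mathrm{sub}}\subseteq\mathcal{J}$, $$\sum_{j\in T(\mathcal{J}_{\mathrm{sub}})}d_j(M_j-d_j)+\sum_{k\in R(\mathcal{J}_{\mathrm{sub}})}d_k(N_k-d_k)\ \ge\ \sum_{(k,j)\in\mathcal{J}_{\mathrm{sub}}}d_jd_k.$$ Equivalently, if any of these inequalities fails for $\chi$, then almost surely the IA problem has no solution.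
   Context: A MIMO interference network has $K$ transmitter-receiver pairs; transmitter $k$ has $M_k$ antennas, receiver $k$ has $N_k$ antennas, and $d_k$ data streams are sent from transmitter $k$ to receiver $k$ ($M_k,N_k,d_k$ positive integers). The channel matrices are $\mathbf{H}_{kj}\in\mathbb{C}^{N_k\times M_j}$, $k,j\in\{1,\dots,K\}$; the entries of all the channel matrices are independent random variables drawn from continuous distributions. IA problem: given $\{\mathbf{H}_{kj}\}$, find $\mathbf{U}_k\in\mathbb{C}^{N_k\times d_k}$ and $\mathbf{V}_k\in\mathbb{C}^{M_k\times d_k}$, $k\in\{1,\dots,K\}$, such that $\mathrm{rank}(\mathbf{U}_k^H\mathbf{H}_{kk}\mathbf{V}_k)=d_k$ for all $k$, and $\mathbf{U}_k^H\mathbf{H}_{kj}\mathbf{V}_j=\mathbf{0}$ for all $k\ne j$. Here $(\cdot)^H$ is the Hermitian transpose. $\mathcal{J}=\{(k,j):k,j\in\{1,\dots,K\},\ k\ne j\}$. For $\mathcal{J}_{\mathrm{sub}}\subseteq\mathcal{J}$, $T(\mathcal{J}_{\mathrm{sub}})=\{j:\exists k,\ (k,j)\in\mathcal{J}_{\mathrm{sub}}\}$ and $R(\mathcal{J}_{\mathrm{sub}})=\{k:\exists j,\ (k,j)\in\mathcal{J}_{\mathrm{sub}}\}$. *)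

theory Defs
  imports
    "HOL-Probability.Probability"
    "Jordan_Normal_Form.Schur_Decomposition"
    "Jordan_Normal_Form.DL_Rank"
begin

text \<open>Users are numbered \<open>1, \<dots>, K\<close>, while the entries of a matrix are indexed from \<open>0\<close>, as usual in
  \<open>Jordan_Normal_Form\<close>. The channel \<open>H k j\<close> is the matrix from transmitter \<open>j\<close> to receiver \<open>k\<close>.\<close>

definition IA_solution ::
  "nat \<Rightarrow> (nat \<Rightarrow> nat) \<Rightarrow> (nat \<Rightarrow> nat) \<Rightarrow> (nat \<Rightarrow> nat) \<Rightarrow> (nat \<Rightarrow> nat \<Rightarrow> complex mat)
    \<Rightarrow> (nat \<Rightarrow> complex mat) \<Rightarrow> (nat \<Rightarrow> complex mat) \<Rightarrow> bool" where
  "IA_solution K M N d H U V \<longleftrightarrow>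
     (\<forall>k\<in>{1..K}. U k \<in> carrier_mat (N k) (d k) \<and> V k \<in> carrier_mat (M k) (d k)) \<and>
     (\<forall>k\<in>{1..K}. vec_space.rank (d k) (mat_adjoint (U k) * H k k * V k) = d k) \<and>
     (\<forall>k\<in>{1..K}. \<forall>j\<in>{1..K}. k \<noteq> j \<longrightarrow> mat_adjoint (U k) * H k j * V j = 0\<^sub>m (d k) (d j))"

definition IA_solvable ::
  "nat \<Rightarrow> (nat \<Rightarrow> nat) \<Rightarrow> (nat \<Rightarrow> nat) \<Rightarrow> (nat \<Rightarrow> nat) \<Rightarrow> (nat \<Rightarrow> nat \<Rightarrow> complex mat) \<Rightarrow> bool" where
  "IA_solvable K M N d H \<longleftrightarrow> (\<exists>U V. IA_solution K M N d H U V)"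

definition cross_links :: "nat \<Rightarrow> (nat \<times> nat) set" where
  "cross_links K = {(k, j). k \<in> {1..K} \<and> j \<in> {1..K} \<and> k \<noteq> j}"

definition tx_set :: "(nat \<times> nat) set \<Rightarrow> nat set" where
  "tx_set J = {j. \<exists>k. (k, j) \<in> J}"

definition rx_set :: "(nat \<times> nat) set \<Rightarrow> nat set" where
  "rx_set J = {k. \<exists>j. (k, j) \<in> J}"

text \<open>A continuous distribution is one without atoms; no density is required.\<close>

definition continuous_distribution :: "complex measure \<Rightarrow> bool" where
  "continuous_distribution D \<longleftrightarrow> (\<forall>z. measure D {z} = 0)"

definition entry_indices ::
  "nat \<Rightarrow> (nat \<Rightarrow> nat) \<Rightarrow> (nat \<Rightarrow> nat) \<Rightarrow> (nat \<times> nat \<times> nat \<times> nat) set" where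
  "entry_indices K M N =
     {(k, j, a, b). k \<in> {1..K} \<and> j \<in> {1..K} \<and> a < N k \<and> b < M j}"

definition channel_entry ::
  "(nat \<Rightarrow> nat \<Rightarrow> 'w \<Rightarrow> complex mat) \<Rightarrow> nat \<times> nat \<times> nat \<times> nat \<Rightarrow> 'w \<Rightarrow> complex" where
  "channel_entry H = (\<lambda>(k, j, a, b) \<omega>. H k j \<omega> $$ (a, b))"

text \<open>Measurability of the entries is part of \<open>indep_vars\<close>.\<close>

definition random_channels ::
  "'w measure \<Rightarrow> nat \<Rightarrow> (nat \<Rightarrow> nat) \<Rightarrow> (nat \<Rightarrow> nat) \<Rightarrow> (nat \<Rightarrow> nat \<Rightarrow> 'w \<Rightarrow> complex mat) \<Rightarrow> bool" where
  "random_channels P K M N H \<longleftrightarrow>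
     prob_space P \<and>
     (\<forall>k\<in>{1..K}. \<forall>j\<in>{1..K}. \<forall>\<omega>\<in>space P. H k j \<omega> \<in> carrier_mat (N k) (M j)) \<and>
     prob_space.indep_vars P (\<lambda>_. borel) (channel_entry H) (entry_indices K M N) \<and>
     (\<forall>i\<in>entry_indices K M N. continuous_distribution (distr P borel (channel_entry H i)))"

end

theory Submission
  imports Defs
begin

text \<open>
  The \<open>q\<close> coordinates of a polynomial map in \<open>p < q\<close> variables satisfy a nontrivial polynomial
  relation, because there are more monomials of bounded degree in \<open>q\<close> than in \<open>p\<close> variables.
  A nonzero polynomial in independent atomless random variables almost surely does not vanish, by
  Fubini and the finiteness of the zero set in one variable. Hence independent atomless random
  variables almost surely avoid the image of such a map, and all genericity is obtained this way.

  For (ii), the channel matrices between \<open>T\<close> and \<open>R\<close> form one block matrix. It is almost surely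
  injective (or its transpose is): a kernel vector with an entry 1 would determine one column by the
  other ones. The image of the block diagonal matrix of the \<open>V\<close>'s for \<open>T\<close> is orthogonal to the
  \<open>U\<close>'s for \<open>R - T\<close>, and counting dimensions gives the claim.

  For (iii), column operations normalise \<open>U\<close> and \<open>V\<close> to contain an identity submatrix. Each alignment
  equation then solves for one channel entry, so the channels lie in the image of a polynomial map
  that has too few parameters if the inequality fails.
\<close>

section \<open>Polynomial maps and atomless random variables\<close>

text \<open>Gaussian elimination: equations and unknowns are removed in pairs, so some unknown
  survives with a free value. Arbitrary index sets let the same count serve for monomials and for
  vectors.\<close>

lemma nontrivial_combination:
  fixes c :: "'a \<Rightarrow> 'b \<Rightarrow> 'f :: field"
  assumes "finite B" "finite A" "card B < card A"
  shows "\<exists>w. (\<exists>a\<in>A. w a \<noteq> 0) \<and> (\<forall>b\<in>B. (\<Sum>a\<in>A. w a * c a b) = 0)"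
  using assms
proof (induction B arbitrary: A c rule: finite_induct)
  case empty
  then obtain a where "a \<in> A" by fastforce
  then show ?case by (intro exI[of _ "\<lambda>_. 1"]) auto
next
  case (insert b B)
  show ?case
  proof (cases "\<forall>a\<in>A. c a b = 0")
    case True
    have "card B < card A" using insert by simp
    from insert.IH[OF insert.prems(1) this, of c] obtain w
      where w: "\<exists>a\<in>A. w a \<noteq> 0" "\<forall>b\<in>B. (\<Sum>a\<in>A. w a * c a b) = 0" by blast
    then show ?thesis using True by (intro exI[of _ w]) auto
  next
    case False
    then obtain a0 where a0: "a0 \<in> A" "c a0 b \<noteq> 0" by blast
    \<comment> \<open>Subtracting this multiple of row \<open>a0\<close> clears the entry of every
      row at \<open>b\<close>.\<close>
    define c' where "c' = (\<lambda>a \<beta>. c a \<beta> - c a b / c a0 b * c a0 \<beta>)"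
    have "card B < card (A - {a0})" "finite (A - {a0})"
      using insert.prems insert.hyps a0(1) by (auto simp: card_Diff_singleton)
    from insert.IH[OF this(2,1), of c'] obtain w
      where w: "\<exists>a\<in>A - {a0}. w a \<noteq> 0" "\<forall>\<beta>\<in>B. (\<Sum>a\<in>A - {a0}. w a * c' a \<beta>) = 0" by blast
    \<comment> \<open>\<open>s\<close> is the value that equation \<open>b\<close> forces on
      \<open>a0\<close>; the remaining equations then reduce to those for \<open>c'\<close>.\<close>
    define s where "s = - (\<Sum>a\<in>A - {a0}. w a * c a b) / c a0 b"
    define w' where "w' = w(a0 := s)"
    have split: "(\<Sum>a\<in>A. w' a * c a \<beta>) = s * c a0 \<beta> + (\<Sum>a\<in>A - {a0}. w a * c a \<beta>)" for \<beta>
      by (subst sum.remove[OF insert.prems(1) a0(1)]) (auto simp: w'_def intro!: sum.cong)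
    have "(\<Sum>a\<in>A. w' a * c a b) = 0"
      using a0 by (simp add: split s_def)
    moreover have "(\<Sum>a\<in>A. w' a * c a \<beta>) = 0" if "\<beta> \<in> B" for \<beta>
    proof -
      have "(\<Sum>a\<in>A - {a0}. w a * c' a \<beta>) =
          (\<Sum>a\<in>A - {a0}. w a * c a \<beta>) - (\<Sum>a\<in>A - {a0}. w a * c a b) / c a0 b * c a0 \<beta>"
        by (simp add: c'_def right_diff_distrib sum_subtractf sum_distrib_right sum_divide_distrib
            mult.assoc)
      then show ?thesis using w(2) that by (simp add: split s_def)
    qed
    moreover have "\<exists>a\<in>A. w' a \<noteq> 0" using w(1) by (auto simp: w'_def)
    ultimately show ?thesis by (intro exI[of _ w']) auto
  qed
qed

section \<open>Polynomial functions of bounded degree\<close>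

definition monomial_at :: "'i set \<Rightarrow> ('i \<Rightarrow> nat) \<Rightarrow> ('i \<Rightarrow> complex) \<Rightarrow> complex" where
  "monomial_at I e x = (\<Prod>i\<in>I. x i ^ e i)"

text \<open>\<open>D\<close> bounds the degree in each variable separately, so that exponents range over a box.\<close>

definition exponents :: "'i set \<Rightarrow> nat \<Rightarrow> ('i \<Rightarrow> nat) set" where
  "exponents I D = PiE I (\<lambda>_. {..D})"

text \<open>Polynomials are functions on total assignments, and \<open>D\<close> is only an upper
  bound, so that bounds can be relaxed and added without tracking exact degrees.\<close>

definition poly_fun :: "'i set \<Rightarrow> nat \<Rightarrow> (('i \<Rightarrow> complex) \<Rightarrow> complex) \<Rightarrow> bool" where
  "poly_fun I D f \<longleftrightarrow> (\<exists>w. \<forall>x. f x = (\<Sum>e\<in>exponents I D. w e * monomial_at I e x))"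

lemma finite_exponents [simp]: "finite I \<Longrightarrow> finite (exponents I D)"
  by (simp add: exponents_def finite_PiE)

lemma card_exponents: "finite I \<Longrightarrow> card (exponents I D) = Suc D ^ card I"
  by (simp add: exponents_def card_funcsetE)

text \<open>Terms sharing an exponent are collected. The closure properties for constants, variables
  and products then only have to exhibit exponents, with repetitions allowed.\<close>

lemma poly_fun_sum_monomials:
  assumes "finite I" "finite A" "\<And>a. a \<in> A \<Longrightarrow> s a \<in> exponents I D"
  shows "poly_fun I D (\<lambda>x. \<Sum>a\<in>A. c a * monomial_at I (s a) x)"
  unfolding poly_fun_def
proof (intro exI allI)
  fix x
  have "(\<Sum>a\<in>A. c a * monomial_at I (s a) x)
      = (\<Sum>e\<in>exponents I D. \<Sum>a\<in>{a\<in>A. s a = e}. c a * monomial_at I (s a) x)"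
    by (rule sum.group[symmetric]) (use assms in auto)
  also have "\<dots> = (\<Sum>e\<in>exponents I D. (\<Sum>a\<in>{a\<in>A. s a = e}. c a) * monomial_at I e x)"
    by (auto simp: sum_distrib_right intro!: sum.cong)
  finally show "(\<Sum>a\<in>A. c a * monomial_at I (s a) x)
      = (\<Sum>e\<in>exponents I D. (\<Sum>a\<in>{a\<in>A. s a = e}. c a) * monomial_at I e x)" .
qed

lemma poly_fun_mono:
  assumes "finite I" "poly_fun I D f" "D \<le> D'"
  shows "poly_fun I D' f"
proof -
  obtain w where w: "f = (\<lambda>x. \<Sum>e\<in>exponents I D. w e * monomial_at I e x)"
    using assms(2) unfolding poly_fun_def by blast
  have "exponents I D \<subseteq> exponents I D'"
    using assms(3) by (auto simp: exponents_def PiE_iff intro: order_trans)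
  then show ?thesis unfolding w
    by (intro poly_fun_sum_monomials) (use assms in auto)
qed

lemma poly_fun_const [simp, intro]:
  assumes "finite I"
  shows "poly_fun I D (\<lambda>x. c)"
proof -
  have "poly_fun I D (\<lambda>x. \<Sum>a\<in>{()}. c * monomial_at I (restrict (\<lambda>_. 0) I) x)"
    by (intro poly_fun_sum_monomials) (use assms in \<open>auto simp: exponents_def\<close>)
  then show ?thesis by (simp add: monomial_at_def)
qed

lemma poly_fun_var:
  assumes "finite I" "i \<in> I" "1 \<le> D"
  shows "poly_fun I D (\<lambda>x. x i)"
proof -
  have "poly_fun I D (\<lambda>x. \<Sum>a\<in>{()}. 1 * monomial_at I (restrict (\<lambda>i'. if i' = i then 1 else 0) I) x)"
    by (intro poly_fun_sum_monomials) (use assms in \<open>auto simp: exponents_def\<close>)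
  moreover have "monomial_at I (restrict (\<lambda>i'. if i' = i then 1 else 0) I) x = x i" for x
  proof -
    have "monomial_at I (restrict (\<lambda>i'. if i' = i then 1 else 0) I) x
        = (\<Prod>i'\<in>I. if i' = i then x i' else 1)"
      by (auto simp: monomial_at_def intro!: prod.cong)
    then show ?thesis using assms by simp
  qed
  ultimately show ?thesis by simp
qed

lemma poly_fun_add:
  assumes "poly_fun I D f" "poly_fun I D g"
  shows "poly_fun I D (\<lambda>x. f x + g x)"
proof -
  obtain w w' where "\<And>x. f x = (\<Sum>e\<in>exponents I D. w e * monomial_at I e x)"
    "\<And>x. g x = (\<Sum>e\<in>exponents I D. w' e * monomial_at I e x)"
    using assms unfolding poly_fun_def by blast
  then show ?thesis unfolding poly_fun_def
    by (intro exI[of _ "\<lambda>e. w e + w' e"]) (simp add: sum.distrib distrib_right)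
qed

lemma poly_fun_mult:
  assumes "finite I" "poly_fun I D f" "poly_fun I D' g"
  shows "poly_fun I (D + D') (\<lambda>x. f x * g x)"
proof -
  obtain w w' where f: "f = (\<lambda>x. \<Sum>e\<in>exponents I D. w e * monomial_at I e x)"
    and g: "g = (\<lambda>x. \<Sum>e\<in>exponents I D'. w' e * monomial_at I e x)"
    using assms(2,3) unfolding poly_fun_def by blast
  \<comment> \<open>Exponents add under multiplication; \<open>restrict\<close> keeps the sum
    extensional, as membership in \<open>exponents\<close> demands.\<close>
  let ?s = "\<lambda>p. restrict (\<lambda>i. fst p i + snd p i) I"
  have "poly_fun I (D + D') (\<lambda>x. \<Sum>p\<in>exponents I D \<times> exponents I D'.
      (w (fst p) * w' (snd p)) * monomial_at I (?s p) x)"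
    by (intro poly_fun_sum_monomials)
      (use assms(1) in \<open>auto simp: exponents_def PiE_iff intro!: add_mono finite_PiE\<close>)
  moreover have "monomial_at I (restrict (\<lambda>i. e i + e' i) I) x = monomial_at I e x * monomial_at I e' x"
    for e e' x
    by (simp add: monomial_at_def power_add prod.distrib)
  ultimately show ?thesis
    unfolding f g sum_product sum.cartesian_product' by (simp add: mult_ac)
qed

lemma poly_fun_uminus:
  assumes "finite I" "poly_fun I D f"
  shows "poly_fun I D (\<lambda>x. - f x)"
  using poly_fun_mult[OF assms(1) poly_fun_const[OF assms(1), of 0 "-1"] assms(2)] by simp

lemma poly_fun_sum:
  assumes "finite I" "\<And>a. a \<in> A \<Longrightarrow> poly_fun I D (f a)"
  shows "poly_fun I D (\<lambda>x. \<Sum>a\<in>A. f a x)"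
  using assms(2)
  by (induction A rule: infinite_finite_induct) (auto intro!: poly_fun_add simp: assms(1))

lemma poly_fun_power:
  assumes "finite I" "poly_fun I D f"
  shows "poly_fun I (n * D) (\<lambda>x. f x ^ n)"
  by (induction n) (use assms in \<open>auto intro!: poly_fun_mult\<close>)

lemma poly_fun_prod:
  assumes "finite I" "finite A" "\<And>a. a \<in> A \<Longrightarrow> poly_fun I D (f a)"
  shows "poly_fun I (card A * D) (\<lambda>x. \<Prod>a\<in>A. f a x)"
  using assms(2,3)
  by (induction A rule: finite_induct) (auto intro!: poly_fun_mult simp: assms(1))

section \<open>Almost sure nonvanishing of polynomials\<close>

text \<open>Splitting off the exponent \<open>k\<close> of the new variable \<open>i\<close>
  exhibits a polynomial as univariate in \<open>i\<close>, with coefficients polynomial in the old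
  variables.\<close>

lemma sum_exponents_insert:
  assumes "finite I" "i \<notin> I"
  shows "(\<Sum>e\<in>exponents (insert i I) D. g e)
      = (\<Sum>k\<le>D. \<Sum>e\<in>exponents I D. g (e(i := k)) :: complex)"
proof -
  have "inj_on (\<lambda>(k, e). e(i := k)) ({..D} \<times> exponents I D)"
    using inj_combinator[OF assms(2), of "\<lambda>_. {..D}"] by (simp add: exponents_def)
  then have "(\<Sum>e\<in>exponents (insert i I) D. g e)
      = (\<Sum>p\<in>{..D} \<times> exponents I D. g ((snd p)(i := fst p)))"
    by (simp add: exponents_def PiE_insert_eq sum.reindex case_prod_unfold comp_def)
  then show ?thesis by (simp add: sum.cartesian_product case_prod_unfold)
qed

text \<open>There are finitely many roots, and each single point is a null set.\<close>

lemma AE_univariate_nonzero: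
  fixes a :: "nat \<Rightarrow> complex"
  assumes "prob_space \<mu>" "sets \<mu> = sets borel" "\<And>z. measure \<mu> {z} = 0" "k \<le> D" "a k \<noteq> 0"
  shows "AE t in \<mu>. (\<Sum>k\<le>D. a k * t ^ k) \<noteq> 0"
proof -
  interpret prob_space \<mu> by fact
  have fin: "finite {t. (\<Sum>k\<le>D. a k * t ^ k) = 0}"
    using assms(4,5) by (intro polyfun_rootbound_finite) auto
  have "AE t in \<mu>. t \<noteq> z" for z
  proof -
    have "{z} \<in> null_sets \<mu>"
      using assms(2,3) by (auto simp: null_sets_def emeasure_eq_measure)
    from AE_not_in[OF this] show ?thesis by simp
  qed
  then have "AE t in \<mu>. \<forall>z\<in>{t. (\<Sum>k\<le>D. a k * t ^ k) = 0}. t \<noteq> z"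
    by (intro AE_finite_allI fin)
  then show ?thesis by eventually_elim auto
qed

text \<open>Induction on the number of variables. Some coefficient with respect to the new variable
  is a nonzero polynomial in the old ones, so it almost surely does not vanish; the univariate case
  then applies for almost every choice of the old variables, and Fubini combines the two.\<close>

lemma AE_PiM_polynomial_nonzero:
  fixes \<mu> :: "'i \<Rightarrow> complex measure"
  assumes "finite I" "\<And>i. prob_space (\<mu> i)" "\<And>i. sets (\<mu> i) = sets borel"
    and atomless: "\<And>i z. i \<in> I \<Longrightarrow> measure (\<mu> i) {z} = 0"
    and "e' \<in> exponents I D" "w e' \<noteq> 0"
  shows "AE y in PiM I \<mu>. (\<Sum>e\<in>exponents I D. w e * monomial_at I e y) \<noteq> 0"
  using assms(1) atomless assms(5,6)
proof (induction I arbitrary: w e' rule: finite_induct)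
  case empty
  then show ?case by (simp add: exponents_def monomial_at_def)
next
  case (insert i I)
  note [measurable_cong] = assms(3)
  interpret i: prob_space "\<mu> i" by (rule assms(2))
  interpret I: prob_space "PiM I \<mu>" by (intro prob_space_PiM assms(2))
  interpret pair_prob_space "PiM I \<mu>" "\<mu> i" ..
  interpret swap: pair_prob_space "\<mu> i" "PiM I \<mu>" ..
  define f where "f = (\<lambda>y. \<Sum>e\<in>exponents (insert i I) D. w e * monomial_at (insert i I) e y)"
  \<comment> \<open>\<open>Q k\<close> is the coefficient of the \<open>k\<close>-th power of the
    new variable.\<close>
  define Q where "Q = (\<lambda>k y. \<Sum>e\<in>exponents I D. w (e(i := k)) * monomial_at I e y)"
  have f_upd: "f (y(i := t)) = (\<Sum>k\<le>D. Q k y * t ^ k)" for y t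
  proof -
    have "monomial_at (insert i I) (e(i := k)) (y(i := t)) = t ^ k * monomial_at I e y" for e k
    proof -
      have "(\<Prod>j\<in>I. (y(i := t)) j ^ (e(i := k)) j) = (\<Prod>j\<in>I. y j ^ e j)"
        by (intro prod.cong refl) (metis insert.hyps(2) fun_upd_other)
      then show ?thesis using insert.hyps by (simp add: monomial_at_def)
    qed
    then show ?thesis using insert.hyps
      by (simp add: f_def Q_def sum_exponents_insert sum_distrib_left mult_ac)
  qed
  \<comment> \<open>The witness \<open>e'\<close> selects a power, \<open>e' i\<close>, whose
    coefficient polynomial is nonzero.\<close>
  have k0: "e' i \<le> D" and e': "restrict e' I \<in> exponents I D" "e' = (restrict e' I)(i := e' i)"
    using insert.prems(2) insert.hyps by (auto simp: exponents_def PiE_iff extensional_def fun_eq_iff)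
  have wn: "w ((restrict e' I)(i := e' i)) \<noteq> 0"
    using insert.prems(3) e'(2) by metis
  have "AE y in PiM I \<mu>. Q (e' i) y \<noteq> 0"
    unfolding Q_def using insert.prems(1) wn 
    by (intro insert.IH[OF _ e'(1), where w = "\<lambda>e. w (e(i := e' i))"] wn) simp_all
  then have "AE y in PiM I \<mu>. AE t in \<mu> i. f (y(i := t)) \<noteq> 0"
  proof eventually_elim
    case (elim y)
    then show ?case unfolding f_upd
      by (intro AE_univariate_nonzero[OF assms(2,3) _ k0]) (use insert.prems in auto)
  qed
  moreover have f_meas [measurable]: "f \<in> borel_measurable (PiM (insert i I) \<mu>)"
    unfolding f_def monomial_at_def by measurable
  have upd [measurable]: "(\<lambda>(t, y). y(i := t)) \<in> \<mu> i \<Otimes>\<^sub>M PiM I \<mu> \<rightarrow>\<^sub>M PiM (insert i I) \<mu>"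
    by measurable
  have "(\<lambda>p. f ((snd p)(i := fst p))) \<in> borel_measurable (\<mu> i \<Otimes>\<^sub>M PiM I \<mu>)"
    using measurable_compose[OF upd f_meas] by (simp add: case_prod_unfold)
  then have ms: "{p \<in> space (\<mu> i \<Otimes>\<^sub>M PiM I \<mu>). f ((snd p)(i := fst p)) \<noteq> 0} \<in> sets (\<mu> i \<Otimes>\<^sub>M PiM I \<mu>)"
    by measurable
  \<comment> \<open>The almost sure quantifiers are exchanged because the product measure is
    assembled with the new coordinate as first factor.\<close>
  ultimately have "AE t in \<mu> i. AE y in PiM I \<mu>. f (y(i := t)) \<noteq> 0"
    by (subst swap.AE_commute) auto
  then have "AE p in \<mu> i \<Otimes>\<^sub>M PiM I \<mu>. f ((snd p)(i := fst p)) \<noteq> 0"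
    by (intro swap.AE_pair_measure ms) auto
  then have "AE y in distr (\<mu> i \<Otimes>\<^sub>M PiM I \<mu>) (PiM (insert i I) \<mu>) (\<lambda>(t, y). y(i := t)). f y \<noteq> 0"
    by (subst AE_distr_iff[OF upd]) (auto simp: case_prod_unfold)
  also have "distr (\<mu> i \<Otimes>\<^sub>M PiM I \<mu>) (PiM (insert i I) \<mu>) (\<lambda>(t, y). y(i := t)) = PiM (insert i I) \<mu>"
    by (intro distr_pair_PiM_eq_PiM assms(2))
  finally show ?case by (simp add: f_def)
qed

lemma AE_indep_polynomial_nonzero:
  fixes X :: "'i \<Rightarrow> 'w \<Rightarrow> complex"
  assumes "prob_space P" "finite I" "prob_space.indep_vars P (\<lambda>_. borel) X I"
    and "\<And>i. i \<in> I \<Longrightarrow> continuous_distribution (distr P borel (X i))"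
    and "e' \<in> exponents I D" "w e' \<noteq> 0"
  shows "AE \<omega> in P. (\<Sum>e\<in>exponents I D. w e * monomial_at I e (\<lambda>i. X i \<omega>)) \<noteq> 0"
\<comment> \<open>The description of independence by a product measure requires a nonempty index
  set.\<close>
proof (cases "I = {}")
  case True
  then show ?thesis using assms by (simp add: exponents_def monomial_at_def)
next
  case False
  interpret prob_space P by fact
  have rv [measurable]: "X i \<in> borel_measurable P" if "i \<in> I" for i
    using assms(3) that by (auto simp: indep_vars_def)
  \<comment> \<open>Outside \<open>I\<close> a point mass is the default, since the product lemma
    asks for a probability measure at every index but for atomlessness only on
    \<open>I\<close>.\<close>
  define \<mu> where "\<mu> = (\<lambda>i. if i \<in> I then distr P borel (X i) else return borel 0)"
  let ?f = "\<lambda>y. \<Sum>e\<in>exponents I D. w e * monomial_at I e y"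
  have "AE y in PiM I \<mu>. ?f y \<noteq> 0"
  proof (rule AE_PiM_polynomial_nonzero[where I = I and e' = e'])
    show "prob_space (\<mu> i)" for i
      by (auto simp: \<mu>_def intro!: prob_space_distr prob_space_return)
    show "measure (\<mu> i) {z} = 0" if "i \<in> I" for i z
      using assms(4)[OF that] that by (simp add: \<mu>_def continuous_distribution_def)
  qed (use assms in \<open>simp_all add: \<mu>_def\<close>)
  also have "PiM I \<mu> = PiM I (\<lambda>i. distr P borel (X i))"
    by (intro PiM_cong) (auto simp: \<mu>_def)
  also have "\<dots> = distr P (PiM I (\<lambda>_. borel)) (\<lambda>\<omega>. \<lambda>i\<in>I. X i \<omega>)"
    using indep_vars_iff_distr_eq_PiM'[OF False, where M' = "\<lambda>_. borel" and X = X] rv assms(3) by simp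
  finally have *: "AE y in distr P (PiM I (\<lambda>_. borel)) (\<lambda>\<omega>. \<lambda>i\<in>I. X i \<omega>). ?f y \<noteq> 0" .
  have "?f \<in> borel_measurable (PiM I (\<lambda>_. borel))"
    unfolding monomial_at_def by measurable
  then have ms: "{y \<in> space (PiM I (\<lambda>_. borel)). ?f y \<noteq> 0} \<in> sets (PiM I (\<lambda>_. borel))"
    by measurable
  have "AE \<omega> in P. ?f (\<lambda>i\<in>I. X i \<omega>) \<noteq> 0"
    using * by (subst (asm) AE_distr_iff[OF _ ms]) (auto intro!: measurable_restrict)
  then show ?thesis by (simp add: monomial_at_def)
qed

section \<open>Algebraic relations and avoidance of polynomial images\<close>

text \<open>Substituting \<open>F\<close> turns a monomial with exponents at most \<open>L\<close>
  into a polynomial in \<open>I\<close> with bound \<open>card Y * (L * D)\<close>. There are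
  \<open>Suc L ^ card Y\<close> such monomials, while the target dimension grows only like
  \<open>L ^ card I\<close>; for large \<open>L\<close> a linear dependence arises, and its
  coefficients form the relation.\<close>

lemma ex_algebraic_relation:
  fixes F :: "'y \<Rightarrow> ('x \<Rightarrow> complex) \<Rightarrow> complex"
  assumes "finite I" "finite Y" "card I < card Y" and F: "\<And>y. y \<in> Y \<Longrightarrow> poly_fun I D (F y)"
  shows "\<exists>L w. (\<exists>e\<in>exponents Y L. w e \<noteq> 0) \<and>
    (\<forall>x. (\<Sum>e\<in>exponents Y L. w e * monomial_at Y e (\<lambda>y. F y x)) = 0)"
proof -
  define q where "q = card Y"
  \<comment> \<open>This \<open>L\<close> equals the constant factor by which the target dimension
    may exceed \<open>Suc L ^ card I\<close>; the extra factor \<open>Suc L\<close> gained from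
    \<open>card I < card Y\<close> beats it.\<close>
  define L where "L = Suc (q * D) ^ card I"
  define E where "E = q * (L * D)"
  have "poly_fun I E (\<lambda>x. monomial_at Y e (\<lambda>y. F y x))" if e: "e \<in> exponents Y L" for e
    unfolding monomial_at_def E_def q_def
  proof (rule poly_fun_prod[OF assms(1,2)])
    fix y assume y: "y \<in> Y"
    then have "e y \<le> L" using e by (auto simp: exponents_def)
    then show "poly_fun I (L * D) (\<lambda>x. F y x ^ e y)"
      by (intro poly_fun_mono[OF assms(1) poly_fun_power[OF assms(1) F[OF y]]]) auto
  qed
  then obtain c where c: "\<And>e x. e \<in> exponents Y L \<Longrightarrow>
      monomial_at Y e (\<lambda>y. F y x) = (\<Sum>b\<in>exponents I E. c e b * monomial_at I b x)"
    unfolding poly_fun_def by metis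
  have "Suc E ^ card I \<le> (Suc (q * D) * Suc L) ^ card I"
    by (intro power_mono) (auto simp: E_def algebra_simps)
  also have "\<dots> = L * Suc L ^ card I"
    unfolding power_mult_distrib by (simp only: L_def)
  also have "\<dots> < Suc L ^ Suc (card I)" by simp
  also have "\<dots> \<le> Suc L ^ card Y" using assms(3) by (intro power_increasing) auto
  finally have "card (exponents I E) < card (exponents Y L)"
    by (simp add: card_exponents assms(1,2))
  then obtain w where w: "\<exists>e\<in>exponents Y L. w e \<noteq> 0"
    and w0: "\<And>b. b \<in> exponents I E \<Longrightarrow> (\<Sum>e\<in>exponents Y L. w e * c e b) = 0"
    using nontrivial_combination[of "exponents I E" "exponents Y L" c] assms(1,2) by auto
  have "(\<Sum>e\<in>exponents Y L. w e * monomial_at Y e (\<lambda>y. F y x)) = 0" for x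
  proof -
    have "(\<Sum>e\<in>exponents Y L. w e * monomial_at Y e (\<lambda>y. F y x))
        = (\<Sum>e\<in>exponents Y L. \<Sum>b\<in>exponents I E. w e * c e b * monomial_at I b x)"
      by (simp add: c sum_distrib_left mult.assoc)
    also have "\<dots> = (\<Sum>b\<in>exponents I E. (\<Sum>e\<in>exponents Y L. w e * c e b) * monomial_at I b x)"
      by (subst sum.swap) (simp add: sum_distrib_right)
    finally show ?thesis using w0 by simp
  qed
  with w show ?thesis by blast
qed

text \<open>The relation satisfied by \<open>F\<close> is a nonzero polynomial that vanishes on the
  whole image, but almost surely not at the random point.\<close>

lemma AE_avoids_polynomial_image:
  fixes X :: "'y \<Rightarrow> 'w \<Rightarrow> complex" and F :: "'y \<Rightarrow> ('x \<Rightarrow> complex) \<Rightarrow> complex"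
  assumes "prob_space P" "finite I" "finite Y" "card I < card Y"
    and "prob_space.indep_vars P (\<lambda>_. borel) X Y"
    and "\<And>y. y \<in> Y \<Longrightarrow> continuous_distribution (distr P borel (X y))"
    and "\<And>y. y \<in> Y \<Longrightarrow> poly_fun I D (F y)"
  shows "AE \<omega> in P. \<not> (\<exists>x. \<forall>y\<in>Y. X y \<omega> = F y x)"
proof -
  obtain L w e' where e': "e' \<in> exponents Y L" "w e' \<noteq> 0"
    and rel: "\<And>x. (\<Sum>e\<in>exponents Y L. w e * monomial_at Y e (\<lambda>y. F y x)) = 0"
    using ex_algebraic_relation[of I Y D F] assms(2-4,7) by blast
  have "AE \<omega> in P. (\<Sum>e\<in>exponents Y L. w e * monomial_at Y e (\<lambda>y. X y \<omega>)) \<noteq> 0"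
    using assms(1,3,5,6) e' by (intro AE_indep_polynomial_nonzero[where I = Y and e' = e'])
  then show ?thesis
  proof eventually_elim
    case (elim \<omega>)
    have "monomial_at Y e (\<lambda>y. X y \<omega>) = monomial_at Y e (\<lambda>y. F y x)"
      if "\<forall>y\<in>Y. X y \<omega> = F y x" for e x
      using that by (simp add: monomial_at_def)
    then have "(\<Sum>e\<in>exponents Y L. w e * monomial_at Y e (\<lambda>y. X y \<omega>)) = 0"
      if "\<forall>y\<in>Y. X y \<omega> = F y x" for x
      using rel[of x] that by (simp only:)
    then show ?case using elim by blast
  qed
qed

section \<open>Dimension counts for block matrices\<close>

text \<open>A kernel vector scaled to 1 at \<open>b0\<close> expresses column \<open>b0\<close>
  through the others. The parameters are then the other columns and \<open>card B - 1\<close>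
  coefficients, fewer than the entries. The indexing \<open>\<iota>\<close> allows use for a matrix
  and for its transpose.\<close>

lemma AE_generic_injective:
  fixes X :: "'i \<Rightarrow> 'w \<Rightarrow> complex" and \<iota> :: "'a \<Rightarrow> 'b \<Rightarrow> 'i"
  assumes "prob_space P" "finite A" "finite B" "card B \<le> card A"
    and inj: "inj_on (case_prod \<iota>) (A \<times> B)"
    and indep: "prob_space.indep_vars P (\<lambda>_. borel) X (case_prod \<iota> ` (A \<times> B))"
    and cont: "\<And>y. y \<in> case_prod \<iota> ` (A \<times> B) \<Longrightarrow> continuous_distribution (distr P borel (X y))"
  shows "AE \<omega> in P. \<forall>x. (\<forall>a\<in>A. (\<Sum>b\<in>B. X (\<iota> a b) \<omega> * x b) = 0) \<longrightarrow> (\<forall>b\<in>B. x b = 0)"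
proof -
  let ?Y = "case_prod \<iota> ` (A \<times> B)"
  \<comment> \<open>\<open>Inl\<close> parameters are matrix entries, \<open>Inr\<close> parameters
    are coefficients of the kernel vector.\<close>
  define G :: "'b \<Rightarrow> 'a \<times> 'b \<Rightarrow> ('a \<times> 'b + 'b \<Rightarrow> complex) \<Rightarrow> complex" where
    "G = (\<lambda>b0 (a, b) x. if b = b0 then - (\<Sum>b\<in>B - {b0}. x (Inl (a, b)) * x (Inr b)) else x (Inl (a, b)))"
  \<comment> \<open>The polynomial map has to be indexed like the random variables, so
    \<open>\<iota>\<close> is inverted.\<close>
  define F where "F = (\<lambda>b0 y. G b0 (inv_into (A \<times> B) (case_prod \<iota>) y))"
  have F: "F b0 (\<iota> a b) = G b0 (a, b)" if "a \<in> A" "b \<in> B" for b0 a b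
    using inv_into_f_f[OF inj, of "(a, b)"] that by (simp add: F_def)
  have "AE \<omega> in P. \<forall>b0\<in>B. \<not> (\<exists>x. \<forall>y\<in>?Y. X y \<omega> = F b0 y x)"
  proof (rule AE_finite_allI[OF assms(3)])
    fix b0 assume b0: "b0 \<in> B"
    define I :: "('a \<times> 'b + 'b) set" where "I = (A \<times> (B - {b0})) <+> (B - {b0})"
    have fin: "finite I" using assms(2,3) by (simp add: I_def)
    have "card I = (card A + 1) * (card B - 1)"
      using b0 assms(2,3) by (simp add: I_def card_Plus card_cartesian_product card_Diff_singleton)
    \<comment> \<open>With \<open>card B = n + 1\<close> this amounts to \<open>n < card A\<close>,
      which is where \<open>card B \<le> card A\<close> enters.\<close>
    also have "\<dots> < card A * card B"
    proof -
      obtain n where "card B = Suc n"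
        using b0 assms(3) by (metis card_gt_0_iff empty_iff gr0_implies_Suc)
      then show ?thesis using assms(4) by simp
    qed
    also have "\<dots> = card ?Y"
      using card_image[OF inj] by (simp add: card_cartesian_product)
    finally have "card I < card ?Y" .
    moreover have "poly_fun I 2 (F b0 y)" if yY: "y \<in> ?Y" for y
    proof -
      obtain a b where y: "y = \<iota> a b" "a \<in> A" "b \<in> B" using yY by auto
      show ?thesis
      proof (cases "b = b0")
        case True
        have "poly_fun I (1 + 1) (\<lambda>x. x (Inl (a, b)) * x (Inr b))" if "b \<in> B - {b0}" for b
          using that y fin by (intro poly_fun_mult poly_fun_var) (auto simp: I_def)
        then have "poly_fun I 2 (\<lambda>x. - (\<Sum>b\<in>B - {b0}. x (Inl (a, b)) * x (Inr b)))"
          by (intro poly_fun_uminus poly_fun_sum fin) (simp add: numeral_2_eq_2)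
        then show ?thesis using True y by (simp add: F G_def)
      next
        case False
        then have "poly_fun I 2 (\<lambda>x. x (Inl (a, b)))"
          using y fin by (intro poly_fun_var) (auto simp: I_def)
        then show ?thesis using False y by (simp add: F G_def)
      qed
    qed
    ultimately show "AE \<omega> in P. \<not> (\<exists>x. \<forall>y\<in>?Y. X y \<omega> = F b0 y x)"
      using assms(1-3) indep cont fin
      by (intro AE_avoids_polynomial_image[where I = I and D = 2]) auto
  qed
  then show ?thesis
  proof eventually_elim
    case (elim \<omega>)
    show ?case
    proof (intro allI impI ballI, rule ccontr)
      fix x b0
      assume x: "\<forall>a\<in>A. (\<Sum>b\<in>B. X (\<iota> a b) \<omega> * x b) = 0" and b0: "b0 \<in> B" "x b0 \<noteq> 0"
      \<comment> \<open>The parameter point consists of the true entries and the kernel vector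
        normalised at \<open>b0\<close>.\<close>
      define z where "z = case_sum (\<lambda>(a, b). X (\<iota> a b) \<omega>) (\<lambda>b. x b / x b0)"
      have "X (\<iota> a b) \<omega> = F b0 (\<iota> a b) z" if "a \<in> A" "b \<in> B" for a b
      proof (cases "b = b0")
        case True
        have "X (\<iota> a b0) \<omega> * x b0 + (\<Sum>b\<in>B - {b0}. X (\<iota> a b) \<omega> * x b) = 0"
          using x that(1) sum.remove[OF assms(3) b0(1), of "\<lambda>b. X (\<iota> a b) \<omega> * x b"] by simp
        then have "X (\<iota> a b0) \<omega> = - (\<Sum>b\<in>B - {b0}. X (\<iota> a b) \<omega> * x b) / x b0"
          using b0(2) by (simp add: field_simps add_eq_0_iff)
        then show ?thesis
          using True that by (simp add: F G_def z_def sum_divide_distrib)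
      next
        case False
        then show ?thesis using that by (simp add: F G_def z_def)
      qed
      then have "\<exists>x. \<forall>y\<in>?Y. X y \<omega> = F b0 y x" by auto
      then show False using elim b0(1) by blast
    qed
  qed
qed

text \<open>The images of the \<open>v j\<close> for \<open>j \<in> T\<close> are orthogonal to the conjugates of the \<open>u k\<close> for
  \<open>k \<in> R - T\<close>, so together they are linearly independent vectors in a space of dimension
  \<open>\<Sum>k\<in>R. N k\<close>.\<close>

lemma block_dimension_bound:
  fixes h :: "nat \<times> nat \<Rightarrow> nat \<times> nat \<Rightarrow> complex" and u v :: "nat \<Rightarrow> nat \<Rightarrow> nat \<Rightarrow> complex"
  assumes fin: "finite R" "finite T"
    and inj: "\<And>x. (\<forall>a\<in>Sigma R (\<lambda>k. {..<N k}). (\<Sum>b\<in>Sigma T (\<lambda>j. {..<M j}). h a b * x b) = 0) \<Longrightarrow>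
        \<forall>b\<in>Sigma T (\<lambda>j. {..<M j}). x b = 0"
    and u: "\<And>k w. k \<in> R \<Longrightarrow> (\<forall>r<N k. (\<Sum>a<d k. w a * u k a r) = 0) \<Longrightarrow> \<forall>a<d k. w a = 0"
    and v: "\<And>j w. j \<in> T \<Longrightarrow> (\<forall>c<M j. (\<Sum>b<d j. w b * v j b c) = 0) \<Longrightarrow> \<forall>b<d j. w b = 0"
    and orth: "\<And>k j a b. k \<in> R \<Longrightarrow> j \<in> T \<Longrightarrow> k \<noteq> j \<Longrightarrow> a < d k \<Longrightarrow> b < d j \<Longrightarrow>
        (\<Sum>r<N k. \<Sum>c<M j. u k a r * h (k, r) (j, c) * v j b c) = 0"
  shows "(\<Sum>j\<in>T \<union> R. d j) \<le> (\<Sum>k\<in>R. N k)"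
proof (rule ccontr)
  assume less: "\<not> ?thesis"
  define A where "A = Sigma R (\<lambda>k. {..<N k})"
  define E where "E = Sigma (T \<union> R) (\<lambda>j. {..<d j})"
  \<comment> \<open>An index \<open>(j, b)\<close> is stream \<open>b\<close> of user
    \<open>j\<close>. A user in both \<open>T\<close> and \<open>R\<close> contributes only its
    \<open>v\<close> part, so its streams are counted once.\<close>
  define z where "z = (\<lambda>(j, b) (k, r). if j \<in> T then \<Sum>c<M j. h (k, r) (j, c) * v j b c
      else if k = j then cnj (u j b r) else 0)"
  have "card A < card E"
    using less fin by (simp add: A_def E_def)
  moreover have "finite A" "finite E" using fin by (auto simp: A_def E_def)
  ultimately obtain w where w: "\<exists>e\<in>E. w e \<noteq> 0" and w0: "\<forall>a\<in>A. (\<Sum>e\<in>E. w e * z e a) = 0"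
    using nontrivial_combination[of A E z] by blast
  \<comment> \<open>\<open>hv\<close> collects the part of the relation coming from
    \<open>T\<close>; \<open>y k\<close> is the part of receiver \<open>k\<close>, supported in the
    rows of that receiver alone.\<close>
  define hv where "hv = (\<lambda>k r. \<Sum>j\<in>T. \<Sum>b<d j. w (j, b) * (\<Sum>c<M j. h (k, r) (j, c) * v j b c))"
  define y where "y = (\<lambda>k r. \<Sum>b<d k. w (k, b) * cnj (u k b r))"
  have split: "hv k r + (if k \<in> T then 0 else y k r) = 0" if k: "k \<in> R" "r < N k" for k r
  proof -
    have "(\<Sum>e\<in>E. w e * z e (k, r)) = (\<Sum>j\<in>T \<union> R. \<Sum>b<d j. w (j, b) * z (j, b) (k, r))"
      unfolding E_def using fin by (subst sum.Sigma) auto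
    also have "\<dots> = (\<Sum>j\<in>T. \<Sum>b<d j. w (j, b) * z (j, b) (k, r))
        + (\<Sum>j\<in>R - T. \<Sum>b<d j. w (j, b) * z (j, b) (k, r))"
      using fin by (subst sum.union_disjoint[symmetric]) auto
    also have "(\<Sum>j\<in>T. \<Sum>b<d j. w (j, b) * z (j, b) (k, r)) = hv k r"
      by (auto simp: hv_def z_def intro!: sum.cong)
    also have "(\<Sum>j\<in>R - T. \<Sum>b<d j. w (j, b) * z (j, b) (k, r))
        = (\<Sum>j\<in>R - T. if k = j then y k r else 0)"
      by (auto simp: y_def z_def intro!: sum.cong)
    also have "\<dots> = (if k \<in> T then 0 else y k r)"
      using k fin by simp
    finally show ?thesis using w0 k by (simp add: A_def)
  qed
  \<comment> \<open>For \<open>k \<in> R - T\<close> every link from \<open>T\<close> to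
    \<open>k\<close> is a cross link, so pairing with \<open>u k a\<close> kills \<open>hv\<close>.
    Hence \<open>y k\<close>, itself a combination of conjugates of the \<open>u k a\<close>, is
    orthogonal to itself and vanishes.\<close>
  have wR: "w (k, a) = 0" if k: "k \<in> R - T" and a: "a < d k" for k a
  proof -
    have uhv: "(\<Sum>r<N k. u k a r * hv k r) = 0" if "a < d k" for a
    proof -
      have "(\<Sum>r<N k. u k a r * hv k r) = (\<Sum>r<N k. \<Sum>j\<in>T. \<Sum>b<d j. w (j, b) *
          (\<Sum>c<M j. u k a r * h (k, r) (j, c) * v j b c))"
        by (simp add: hv_def sum_distrib_left mult_ac)
      also have "\<dots> = (\<Sum>j\<in>T. \<Sum>b<d j. \<Sum>r<N k. w (j, b) *
          (\<Sum>c<M j. u k a r * h (k, r) (j, c) * v j b c))"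
        by (subst sum.swap, rule sum.cong[OF refl], rule sum.swap)
      also have "\<dots> = (\<Sum>j\<in>T. \<Sum>b<d j. w (j, b) *
          (\<Sum>r<N k. \<Sum>c<M j. u k a r * h (k, r) (j, c) * v j b c))"
        by (simp add: sum_distrib_left)
      also have "\<dots> = 0" using k that by (intro sum.neutral ballI) (simp, intro disjI2 orth, auto)
      finally show ?thesis .
    qed
    have hv: "hv k r = - y k r" if "r < N k" for r
      using split[of k r] k that by (simp add: add_eq_0_iff)
    have uy: "(\<Sum>r<N k. u k a r * y k r) = 0" if "a < d k" for a
      using uhv[OF that] by (simp add: hv sum_negf)
    have "(\<Sum>r<N k. cnj (y k r) * y k r) = (\<Sum>r<N k. \<Sum>a<d k. cnj (w (k, a)) * (u k a r * y k r))"
      by (simp add: y_def sum_distrib_right mult_ac)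
    also have "\<dots> = (\<Sum>a<d k. cnj (w (k, a)) * (\<Sum>r<N k. u k a r * y k r))"
      by (subst sum.swap) (simp add: sum_distrib_left)
    also have "\<dots> = 0" by (simp add: uy)
    finally have "(\<Sum>r<N k. cnj (y k r) * y k r) = 0" .
    moreover have "(\<Sum>r<N k. cnj (y k r) * y k r) = of_real (\<Sum>r<N k. (cmod (y k r))\<^sup>2)"
      by (simp only: of_real_sum complex_norm_square mult.commute)
    ultimately have "(\<Sum>r<N k. (cmod (y k r))\<^sup>2) = 0" by (simp only: of_real_eq_0_iff)
    then have y0: "y k r = 0" if "r < N k" for r
      using that by (subst (asm) sum_nonneg_eq_0_iff) auto
    \<comment> \<open>Conjugation turns the vanishing of \<open>y k\<close> into a relation between
      the \<open>u k a\<close>, whose independence is assumed.\<close>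
    have "(\<Sum>a<d k. cnj (w (k, a)) * u k a r) = cnj (y k r)" for r
      by (simp add: y_def)
    then have "\<forall>a<d k. cnj (w (k, a)) = 0"
      using k y0 by (intro u) auto
    then show ?thesis using a by simp
  qed
  have hv0: "hv k r = 0" if "k \<in> R" "r < N k" for k r
    using split[OF that] wR that by (auto simp: y_def split: if_splits)
  \<comment> \<open>\<open>x\<close> is the image of \<open>w\<close> under the block diagonal
    matrix of the \<open>v j\<close>; it lies in the kernel of \<open>h\<close>.\<close>
  define x where "x = (\<lambda>(j, c). \<Sum>b<d j. w (j, b) * v j b c)"
  have "(\<Sum>b\<in>Sigma T (\<lambda>j. {..<M j}). h (k, r) b * x b) = hv k r" for k r
  proof -
    have "(\<Sum>b\<in>Sigma T (\<lambda>j. {..<M j}). h (k, r) b * x b)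
        = (\<Sum>j\<in>T. \<Sum>c<M j. h (k, r) (j, c) * x (j, c))"
      using fin by (subst sum.Sigma) auto
    also have "\<dots> = (\<Sum>j\<in>T. \<Sum>c<M j. \<Sum>b<d j. w (j, b) * (h (k, r) (j, c) * v j b c))"
      by (simp add: x_def sum_distrib_left mult_ac)
    also have "\<dots> = hv k r"
      unfolding hv_def by (subst sum.swap) (simp add: sum_distrib_left)
    finally show ?thesis .
  qed
  then have "\<forall>b\<in>Sigma T (\<lambda>j. {..<M j}). x b = 0"
    using hv0 by (intro inj) auto
  then have "w (j, b) = 0" if "j \<in> T" "b < d j" for j b
    using v[OF that(1), of "\<lambda>b. w (j, b)"] that by (auto simp: x_def)
  with wR w show False by (auto simp: E_def)
qed

section \<open>Normalised solutions\<close>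

text \<open>Applied to the columns of the \<open>U\<close> and \<open>V\<close> matrices, this
  yields (i).\<close>

lemma independent_imp_le_dim:
  fixes v :: "nat \<Rightarrow> nat \<Rightarrow> 'f :: field"
  assumes "\<And>w. (\<forall>c<m. (\<Sum>b<d. w b * v b c) = 0) \<Longrightarrow> \<forall>b<d. w b = 0"
  shows "d \<le> m"
proof (rule ccontr)
  assume "\<not> d \<le> m"
  then obtain w where "\<exists>b<d. w b \<noteq> 0" "\<forall>c<m. (\<Sum>b<d. w b * v b c) = 0"
    using nontrivial_combination[of "{..<m}" "{..<d}" v] by auto
  with assms show False by blast
qed

text \<open>Gauss-Jordan elimination, adding one vector at a time: \<open>\<rho>\<close> lists the
  pivot coordinates and \<open>B\<close> is the inverse of the square submatrix found there.\<close>

lemma ex_normalised_basis: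
  fixes v :: "nat \<Rightarrow> nat \<Rightarrow> 'f :: field"
  assumes "\<And>w. (\<forall>c<m. (\<Sum>b<d. w b * v b c) = 0) \<Longrightarrow> \<forall>b<d. w b = 0"
  shows "\<exists>\<rho> B. (\<forall>b<d. \<rho> b < m) \<and>
    (\<forall>b<d. \<forall>b'<d. (\<Sum>\<beta><d. B b \<beta> * v \<beta> (\<rho> b')) = (if b = b' then 1 else 0))"
  using assms
proof (induction d)
  case 0
  then show ?case by simp
next
  case (Suc d)
  have "\<forall>b<d. w b = 0" if "\<forall>c<m. (\<Sum>b<d. w b * v b c) = 0" for w
  proof -
    have "\<forall>b<Suc d. (w(d := 0)) b = 0" using that by (intro Suc.prems) simp
    then show ?thesis by (metis fun_upd_other less_Suc_eq less_irrefl)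
  qed
  from Suc.IH[OF this] obtain \<rho> B where \<rho>: "\<forall>b<d. \<rho> b < m"
    and B: "\<And>b b'. b < d \<Longrightarrow> b' < d \<Longrightarrow> (\<Sum>\<beta><d. B b \<beta> * v \<beta> (\<rho> b')) = (if b = b' then 1 else 0)"
    by blast
  \<comment> \<open>\<open>S\<close> is the normalised family so far, \<open>v'\<close> the new
    vector reduced so as to vanish at the old pivots, and \<open>g\<close> its coefficients in the
    original family.\<close>
  define S where "S = (\<lambda>b c. \<Sum>\<beta><d. B b \<beta> * v \<beta> c)"
  define v' where "v' = (\<lambda>c. v d c - (\<Sum>b<d. v d (\<rho> b) * S b c))"
  define g where "g = (\<lambda>\<beta>. if \<beta> = d then 1 else - (\<Sum>b<d. v d (\<rho> b) * B b \<beta>))"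
  have g: "(\<Sum>\<beta><Suc d. g \<beta> * v \<beta> c) = v' c" for c
  proof -
    have "(\<Sum>\<beta><d. g \<beta> * v \<beta> c) = - (\<Sum>\<beta><d. \<Sum>b<d. v d (\<rho> b) * (B b \<beta> * v \<beta> c))"
      by (simp add: g_def sum_distrib_right sum_negf mult.assoc)
    also have "\<dots> = - (\<Sum>b<d. v d (\<rho> b) * S b c)"
      by (subst sum.swap) (simp add: S_def sum_distrib_left)
    finally show ?thesis by (simp add: g_def v'_def)
  qed
  \<comment> \<open>\<open>g\<close> has entry 1 at \<open>d\<close>, so independence makes
    \<open>v'\<close> nonzero at some coordinate, which becomes the new pivot.\<close>
  have "\<not> (\<forall>c<m. (\<Sum>\<beta><Suc d. g \<beta> * v \<beta> c) = 0)"
    using Suc.prems[of g] by (metis g_def lessI zero_neq_one)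
  then obtain r where r: "r < m" "v' r \<noteq> 0" by (auto simp: g simp del: sum.lessThan_Suc)
  have v'\<rho>: "v' (\<rho> b) = 0" if "b < d" for b
  proof -
    have "(\<Sum>b'<d. v d (\<rho> b') * S b' (\<rho> b)) = (\<Sum>b'<d. if b' = b then v d (\<rho> b') else 0)"
      using B that by (intro sum.cong) (auto simp: S_def)
    then show ?thesis using that by (simp add: v'_def)
  qed
  \<comment> \<open>The new vector is scaled to 1 at \<open>r\<close>, and the multiple of it that
    clears coordinate \<open>r\<close> is subtracted from each old one.\<close>
  define B' where "B' = (\<lambda>b \<beta>. if b = d then g \<beta> / v' r
      else (if \<beta> < d then B b \<beta> else 0) - S b r * (g \<beta> / v' r))"
  have gr: "(\<Sum>\<beta><Suc d. g \<beta> / v' r * v \<beta> c) = v' c / v' r" for c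
    by (simp add: g[symmetric] sum_divide_distrib add_divide_distrib)
  have B'd: "(\<Sum>\<beta><Suc d. B' d \<beta> * v \<beta> c) = v' c / v' r" for c
    using gr[of c] by (simp add: B'_def)
  have B'b: "(\<Sum>\<beta><Suc d. B' b \<beta> * v \<beta> c) = S b c - S b r * (v' c / v' r)" if "b < d" for b c
  proof -
    have "(\<Sum>\<beta><Suc d. B' b \<beta> * v \<beta> c)
        = (\<Sum>\<beta><Suc d. (if \<beta> < d then B b \<beta> else 0) * v \<beta> c - S b r * (g \<beta> / v' r * v \<beta> c))"
      using that by (intro sum.cong) (auto simp: B'_def algebra_simps)
    also have "\<dots> = S b c - S b r * (v' c / v' r)"
      unfolding sum_subtractf sum_distrib_left[symmetric] gr by (simp add: S_def)
    finally show ?thesis .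
  qed
  define \<rho>' where "\<rho>' = \<rho>(d := r)"
  have "(\<Sum>\<beta><Suc d. B' b \<beta> * v \<beta> (\<rho>' b')) = (if b = b' then 1 else 0)"
    if "b < Suc d" "b' < Suc d" for b b'
  proof (cases "b = d")
    case True
    then show ?thesis using that r v'\<rho>
      by (cases "b' = d") (simp_all only: B'd, auto simp: \<rho>'_def)
  next
    case False
    then show ?thesis using that r v'\<rho> B
      by (cases "b' = d") (simp_all add: B'b \<rho>'_def del: sum.lessThan_Suc, auto simp: S_def)
  qed
  moreover have "\<forall>b<Suc d. \<rho>' b < m" using \<rho> r by (auto simp: \<rho>'_def less_Suc_eq)
  ultimately show ?case by blast
qed

lemma kronecker_imp_inj_on:
  assumes "\<And>a a'. a < d \<Longrightarrow> a' < d \<Longrightarrow> f a (\<sigma> a') = (if a = a' then 1 else 0 :: 'f :: zero_neq_one)"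
  shows "inj_on \<sigma> {..<d :: nat}"
proof (rule inj_onI)
  fix a a' assume "a \<in> {..<d}" "a' \<in> {..<d}" "\<sigma> a = \<sigma> a'"
  then show "a = a'" using assms[of a a] assms[of a a'] by (auto split: if_splits)
qed

text \<open>The entries of the channel \<open>(k, j)\<close> in the rows \<open>\<sigma> k a\<close> and columns \<open>\<rho> j b\<close> are called pivots.
  For normalised \<open>u\<close> and \<open>v\<close>, the equation with indices \<open>a, b\<close> expresses one pivot polynomially in
  terms of the other channel entries and the free coefficients of \<open>u\<close> and \<open>v\<close>.\<close>

lemma AE_no_normalised_solution:
  fixes X :: "nat \<times> nat \<times> nat \<times> nat \<Rightarrow> 'w \<Rightarrow> complex"
  assumes "prob_space P" and J: "finite J"
    and indep: "prob_space.indep_vars P (\<lambda>_. borel) X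
        {(k, j, r, c). (k, j) \<in> J \<and> r < N k \<and> c < M j}"
    and cont: "\<And>k j r c. (k, j) \<in> J \<Longrightarrow> r < N k \<Longrightarrow> c < M j \<Longrightarrow>
        continuous_distribution (distr P borel (X (k, j, r, c)))"
    and \<sigma>: "\<And>k. k \<in> rx_set J \<Longrightarrow> inj_on (\<sigma> k) {..<d k}"
      "\<And>k a. k \<in> rx_set J \<Longrightarrow> a < d k \<Longrightarrow> \<sigma> k a < N k"
    and \<rho>: "\<And>j. j \<in> tx_set J \<Longrightarrow> inj_on (\<rho> j) {..<d j}"
      "\<And>j b. j \<in> tx_set J \<Longrightarrow> b < d j \<Longrightarrow> \<rho> j b < M j"
    and less: "(\<Sum>j\<in>tx_set J. d j * (M j - d j)) + (\<Sum>k\<in>rx_set J. d k * (N k - d k))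
        < (\<Sum>(k, j)\<in>J. d j * d k)"
  shows "AE \<omega> in P. \<not> (\<exists>u v.
    (\<forall>k\<in>rx_set J. \<forall>a<d k. \<forall>a'<d k. u k a (\<sigma> k a') = (if a = a' then 1 else 0)) \<and>
    (\<forall>j\<in>tx_set J. \<forall>b<d j. \<forall>b'<d j. v j b (\<rho> j b') = (if b = b' then 1 else 0)) \<and>
    (\<forall>(k, j)\<in>J. \<forall>a<d k. \<forall>b<d j.
      (\<Sum>r<N k. \<Sum>c<M j. u k a r * X (k, j, r, c) \<omega> * v j b c) = 0))"
proof -
  let ?T = "tx_set J" and ?R = "rx_set J"
  have JRT: "k \<in> ?R" "j \<in> ?T" if "(k, j) \<in> J" for k j
    using that by (auto simp: tx_set_def rx_set_def)
  have "?T = snd ` J" "?R = fst ` J" by (force simp: tx_set_def rx_set_def)+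
  then have finT: "finite ?T" and finR: "finite ?R" using J by auto
  define Sr where "Sr = (\<lambda>k. \<sigma> k ` {..<d k})"
  define Sc where "Sc = (\<lambda>j. \<rho> j ` {..<d j})"
  define Y where "Y = {(k, j, r, c). (k, j) \<in> J \<and> r < N k \<and> c < M j}"
  define Piv where "Piv = {(k, j, r, c). (k, j) \<in> J \<and> r \<in> Sr k \<and> c \<in> Sc j}"
  define Us where "Us = Sigma ?R (\<lambda>k. {..<d k} \<times> ({..<N k} - Sr k))"
  define Vs where "Vs = Sigma ?T (\<lambda>j. {..<d j} \<times> ({..<M j} - Sc j))"
  \<comment> \<open>The summands hold the non-pivot channel entries and the free coefficients of
    \<open>u\<close> and of \<open>v\<close>.\<close>
  define I :: "(nat \<times> nat \<times> nat \<times> nat + nat \<times> nat \<times> nat + nat \<times> nat \<times> nat) set"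
    where "I = (Y - Piv) <+> (Us <+> Vs)"

  have Piv_sub: "Piv \<subseteq> Y" using \<sigma>(2) \<rho>(2) JRT by (auto simp: Piv_def Y_def Sr_def Sc_def)
  \<comment> \<open>Regrouping the indices by link makes finiteness and cardinality
    computable.\<close>
  have flat: "{(k, j, r, c). (k, j) \<in> J \<and> r \<in> A k \<and> c \<in> B j}
      = (\<lambda>((k, j), (r, c)). (k, j, r, c)) ` Sigma J (\<lambda>(k, j). A k \<times> B j)"
    for A B :: "nat \<Rightarrow> nat set" by (force simp: image_iff)
  have inj_flat: "inj_on (\<lambda>((k, j), (r, c)). (k, j, r, c)) S" for S :: "((nat \<times> nat) \<times> nat \<times> nat) set"
    by (auto simp: inj_on_def)
  have Y_eq: "Y = {(k, j, r, c). (k, j) \<in> J \<and> r \<in> {..<N k} \<and> c \<in> {..<M j}}"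
    by (simp add: Y_def)
  have finY: "finite Y"
    unfolding Y_eq flat using J by (intro finite_imageI finite_SigmaI) auto
  have card_Sr: "card (Sr k) = d k" if "k \<in> ?R" for k
    using card_image[OF \<sigma>(1)[OF that]] by (simp add: Sr_def)
  have card_Sc: "card (Sc j) = d j" if "j \<in> ?T" for j
    using card_image[OF \<rho>(1)[OF that]] by (simp add: Sc_def)
  have "card Piv = (\<Sum>p\<in>J. card (case p of (k, j) \<Rightarrow> Sr k \<times> Sc j))"
    unfolding Piv_def flat card_image[OF inj_flat]
    by (intro card_SigmaI J) (auto simp: Sr_def Sc_def)
  also have "\<dots> = (\<Sum>(k, j)\<in>J. d j * d k)"
    by (intro sum.cong refl) (auto simp: card_cartesian_product card_Sr card_Sc JRT)
  finally have card_Piv: "card Piv = (\<Sum>(k, j)\<in>J. d j * d k)" .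
  have "card Us = (\<Sum>k\<in>?R. d k * (N k - d k))"
  proof -
    have "card ({..<N k} - Sr k) = N k - d k" if "k \<in> ?R" for k
      using card_Diff_subset[of "Sr k" "{..<N k}"] card_Sr[OF that] \<sigma>(2)[OF that]
      by (auto simp: Sr_def)
    then show ?thesis by (simp add: Us_def finR card_cartesian_product)
  qed
  moreover have "card Vs = (\<Sum>j\<in>?T. d j * (M j - d j))"
  proof -
    have "card ({..<M j} - Sc j) = M j - d j" if "j \<in> ?T" for j
      using card_Diff_subset[of "Sc j" "{..<M j}"] card_Sc[OF that] \<rho>(2)[OF that]
      by (auto simp: Sc_def)
    then show ?thesis by (simp add: Vs_def finT card_cartesian_product)
  qed
  moreover have finUV: "finite Us" "finite Vs" using finR finT by (auto simp: Us_def Vs_def)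
  moreover have "card (Y - Piv) = card Y - card Piv"
    using Piv_sub finY by (simp add: card_Diff_subset finite_subset)
  moreover have "card Piv \<le> card Y" using Piv_sub finY by (rule card_mono[rotated])
  \<comment> \<open>By \<open>less\<close>, \<open>Us\<close> and \<open>Vs\<close> together have
    fewer elements than \<open>Piv\<close>; \<open>card Piv \<le> card Y\<close> keeps the truncated
    subtraction exact.\<close>
  ultimately have cardI: "card I < card Y"
    using less finY by (simp add: I_def card_Plus card_Piv)
  have finI: "finite I" using finY finUV by (simp add: I_def)

  \<comment> \<open>The identity submatrix is hard-wired on the pivot rows; all other coefficients
    are parameters.\<close>
  define uf where "uf = (\<lambda>k a r (x :: _ \<Rightarrow> complex).
    if r \<in> Sr k then (if r = \<sigma> k a then 1 else 0)
    else x (Inr (Inl (k, a, r)) :: nat \<times> nat \<times> nat \<times> nat + nat \<times> nat \<times> nat + nat \<times> nat \<times> nat))"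
  define vf where "vf = (\<lambda>j b c (x :: _ \<Rightarrow> complex).
    if c \<in> Sc j then (if c = \<rho> j b then 1 else 0)
    else x (Inr (Inr (j, b, c)) :: nat \<times> nat \<times> nat \<times> nat + nat \<times> nat \<times> nat + nat \<times> nat \<times> nat))"
  \<comment> \<open>All pivot terms are dropped: for equation \<open>a, b\<close> only the one at
    \<open>\<sigma> k a\<close>, \<open>\<rho> j b\<close> has a nonzero coefficient, namely 1. As
    no pivot remains in \<open>rest\<close>, each equation solves for its own pivot.\<close>
  define rest where "rest = (\<lambda>k j a b x. \<Sum>r<N k. \<Sum>c<M j.
    if r \<in> Sr k \<and> c \<in> Sc j then 0 else uf k a r x * x (Inl (k, j, r, c)) * vf j b c x)"
  \<comment> \<open>Inverting \<open>\<sigma> k\<close> and \<open>\<rho> j\<close> recovers from a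
    pivot position the equation that determines it.\<close>
  define F where "F = (\<lambda>(k, j, r, c) x. if r \<in> Sr k \<and> c \<in> Sc j
    then - rest k j (inv_into {..<d k} (\<sigma> k) r) (inv_into {..<d j} (\<rho> j) c) x
    else x (Inl (k, j, r, c)))"
  have F_piv: "F (k, j, \<sigma> k a, \<rho> j b) x = - rest k j a b x"
    if "(k, j) \<in> J" "a < d k" "b < d j" for k j a b x
    using that \<sigma>(1) \<rho>(1) JRT[OF that(1)] by (auto simp: F_def Sr_def Sc_def)

  have poly_u: "poly_fun I 1 (uf k a r)" if "k \<in> ?R" "a < d k" "r < N k" for k a r
    using that finI by (cases "r \<in> Sr k") (auto simp: uf_def I_def Us_def intro!: poly_fun_var)
  have poly_v: "poly_fun I 1 (vf j b c)" if "j \<in> ?T" "b < d j" "c < M j" for j b c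
    using that finI by (cases "c \<in> Sc j") (auto simp: vf_def I_def Vs_def intro!: poly_fun_var)
  have poly_rest: "poly_fun I 3 (rest k j a b)" if "(k, j) \<in> J" "a < d k" "b < d j" for k j a b
    unfolding rest_def
  proof (intro poly_fun_sum finI)
    fix r c assume rc: "r \<in> {..<N k}" "c \<in> {..<M j}"
    have "poly_fun I (1 + 1 + 1) (\<lambda>x. uf k a r x * x (Inl (k, j, r, c)) * vf j b c x)"
      if "\<not> (r \<in> Sr k \<and> c \<in> Sc j)"
      using that rc \<open>(k, j) \<in> J\<close> \<open>a < d k\<close> \<open>b < d j\<close> JRT[OF \<open>(k, j) \<in> J\<close>] finI
      by (intro poly_fun_mult poly_u poly_v poly_fun_var finI) (auto simp: I_def Y_def Piv_def)
    then show "poly_fun I 3 (\<lambda>x. if r \<in> Sr k \<and> c \<in> Sc j then 0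
        else uf k a r x * x (Inl (k, j, r, c)) * vf j b c x)"
      using finI
      by (cases "r \<in> Sr k"; cases "c \<in> Sc j") (simp_all add: numeral_3_eq_3)
  qed
  have poly_F: "poly_fun I 3 (F y)" if "y \<in> Y" for y
  proof -
    obtain k j r c where y: "y = (k, j, r, c)" and kj: "(k, j) \<in> J"
      using \<open>y \<in> Y\<close> by (auto simp: Y_def)
    show ?thesis
    proof (cases "y \<in> Piv")
      case True
      then obtain a b where ab: "r = \<sigma> k a" "a < d k" "c = \<rho> j b" "b < d j"
        by (auto simp: y Piv_def Sr_def Sc_def)
      then have "F y = (\<lambda>x. - rest k j a b x)" by (simp add: y F_piv[OF kj] fun_eq_iff)
      then show ?thesis using poly_fun_uminus[OF finI poly_rest[OF kj ab(2,4)]] by simp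
    next
      case False
      then have "F y = (\<lambda>x. x (Inl y))" using kj by (auto simp: y F_def Piv_def)
      then show ?thesis
        using finI \<open>y \<in> Y\<close> False by (auto simp: I_def intro!: poly_fun_var)
    qed
  qed
  have "AE \<omega> in P. \<not> (\<exists>x. \<forall>y\<in>Y. X y \<omega> = F y x)"
    using assms(1) finI finY cardI indep cont poly_F
    by (intro AE_avoids_polynomial_image[where I = I and D = 3]) (auto simp: Y_def)
  then show ?thesis
  proof eventually_elim
    case (elim \<omega>)
    show ?case
    proof (rule notI, elim exE conjE)
      fix u v
      assume u: "\<forall>k\<in>?R. \<forall>a<d k. \<forall>a'<d k. u k a (\<sigma> k a') = (if a = a' then 1 else 0)"
        and v: "\<forall>j\<in>?T. \<forall>b<d j. \<forall>b'<d j. v j b (\<rho> j b') = (if b = b' then 1 else 0)"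
        and eqs: "\<forall>(k, j)\<in>J. \<forall>a<d k. \<forall>b<d j.
          (\<Sum>r<N k. \<Sum>c<M j. u k a r * X (k, j, r, c) \<omega> * v j b c) = 0"
      \<comment> \<open>The parameters are read off from the supposed solution and the actual
        channels.\<close>
      define z where "z = case_sum (\<lambda>y. X y \<omega>)
        (case_sum (\<lambda>(k, a, r). u k a r) (\<lambda>(j, b, c). v j b c))"
      have uz: "uf k a r z = u k a r" if "k \<in> ?R" "a < d k" for k a r
        using that u inj_onD[OF \<sigma>(1)[OF that(1)]] by (auto simp: uf_def z_def Sr_def)
      have vz: "vf j b c z = v j b c" if "j \<in> ?T" "b < d j" for j b c
        using that v inj_onD[OF \<rho>(1)[OF that(1)]] by (auto simp: vf_def z_def Sc_def)
      have piv: "X (k, j, \<sigma> k a, \<rho> j b) \<omega> = - rest k j a b z"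
        if kj: "(k, j) \<in> J" and ab: "a < d k" "b < d j" for k j a b
      proof -
        note RT = JRT[OF kj]
        have "0 = (\<Sum>r<N k. \<Sum>c<M j. u k a r * X (k, j, r, c) \<omega> * v j b c)"
          using eqs kj ab by fastforce
        also have "\<dots> = (\<Sum>r<N k. \<Sum>c<M j.
              (if r = \<sigma> k a then if c = \<rho> j b then X (k, j, r, c) \<omega> else 0 else 0)
            + (if r \<in> Sr k \<and> c \<in> Sc j then 0 else uf k a r z * z (Inl (k, j, r, c)) * vf j b c z))"
        proof (intro sum.cong refl)
          fix r c
          show "u k a r * X (k, j, r, c) \<omega> * v j b c =
              (if r = \<sigma> k a then if c = \<rho> j b then X (k, j, r, c) \<omega> else 0 else 0)
            + (if r \<in> Sr k \<and> c \<in> Sc j then 0 else uf k a r z * z (Inl (k, j, r, c)) * vf j b c z)"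
            unfolding uz[OF RT(1) ab(1), symmetric] vz[OF RT(2) ab(2), symmetric]
            using ab by (auto simp: z_def uf_def vf_def Sr_def Sc_def)
        qed
        also have "\<dots> = (\<Sum>r<N k. \<Sum>c<M j.
              if r = \<sigma> k a then if c = \<rho> j b then X (k, j, r, c) \<omega> else 0 else 0)
            + rest k j a b z"
          by (simp add: rest_def sum.distrib)
        also have "(\<Sum>r<N k. \<Sum>c<M j.
              if r = \<sigma> k a then if c = \<rho> j b then X (k, j, r, c) \<omega> else 0 else 0)
            = (\<Sum>r<N k. if r = \<sigma> k a then X (k, j, r, \<rho> j b) \<omega> else 0)"
          using \<rho>(2)[OF RT(2) ab(2)] by (intro sum.cong) auto
        also have "\<dots> = X (k, j, \<sigma> k a, \<rho> j b) \<omega>"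
          using \<sigma>(2)[OF RT(1) ab(1)] by simp
        finally show ?thesis by (simp add: eq_neg_iff_add_eq_0)
      qed
      have "X y \<omega> = F y z" if "y \<in> Y" for y
      proof -
        obtain k j r c where y: "y = (k, j, r, c)" and kj: "(k, j) \<in> J"
          using \<open>y \<in> Y\<close> by (auto simp: Y_def)
        show ?thesis
        proof (cases "y \<in> Piv")
          case True
          then obtain a b where "r = \<sigma> k a" "a < d k" "c = \<rho> j b" "b < d j"
            by (auto simp: y Piv_def Sr_def Sc_def)
          then show ?thesis using kj by (simp add: y F_piv piv)
        next
          case False
          then show ?thesis using kj by (auto simp: y F_def Piv_def z_def)
        qed
      qed
      with elim show False by blast
    qed
  qed
qed

section \<open>Interference alignment\<close>

text \<open>A kernel vector of \<open>B\<close> is one of \<open>A * B\<close>.\<close>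

lemma columns_independent_of_det_mult:
  fixes A B :: "complex mat"
  assumes A: "A \<in> carrier_mat d n" and B: "B \<in> carrier_mat n d" and det: "det (A * B) \<noteq> 0"
    and w: "\<forall>c<n. (\<Sum>b<d. w b * B $$ (c, b)) = 0"
  shows "\<forall>b<d. w b = 0"
proof -
  have "B *\<^sub>v vec d w = 0\<^sub>v n"
    using B w by (intro eq_vecI) (auto simp: scalar_prod_def mult_ac atLeast0LessThan)
  then have "(A * B) *\<^sub>v vec d w = 0\<^sub>v d"
    using A B by (subst assoc_mult_mat_vec[of _ d n _ d]) auto
  then have "vec d w = 0\<^sub>v d"
    using det det_0_iff_vec_prod_zero[of "A * B" d] A B by (metis mult_carrier_mat vec_carrier)
  then show ?thesis by (metis index_vec index_zero_vec(1))
qed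

lemma mat_adjoint_index:
  fixes A :: "complex mat"
  assumes "A \<in> carrier_mat n d" "a < d" "r < n"
  shows "mat_adjoint A $$ (a, r) = cnj (A $$ (r, a))"
  using assms by (simp add: mat_adjoint_def mat_of_rows_def)

lemma mat_adjoint_carrier:
  "A \<in> carrier_mat n d \<Longrightarrow> mat_adjoint A \<in> carrier_mat d n"
  by (auto simp: mat_adjoint_def)

lemma index_mult_mult_mat:
  fixes A B C :: "complex mat"
  assumes "A \<in> carrier_mat p n" "B \<in> carrier_mat n m" "C \<in> carrier_mat m q" "a < p" "b < q"
  shows "(A * B * C) $$ (a, b) = (\<Sum>r<n. \<Sum>c<m. A $$ (a, r) * B $$ (r, c) * C $$ (c, b))"
  using assms by (simp add: scalar_prod_def atLeast0LessThan sum_distrib_left mult.assoc)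

text \<open>The rank condition enters through a nonzero determinant, which forces independent
  columns. Because of the conjugation \<open>u k a\<close> is a row of the Hermitian transpose, so
  the equations are polynomial in \<open>u\<close> and \<open>v\<close>.\<close>

lemma IA_solution_coordinates:
  assumes sol: "IA_solution K M N d H U V"
    and carrier: "\<forall>k\<in>{1..K}. \<forall>j\<in>{1..K}. H k j \<in> carrier_mat (N k) (M j)"
  defines "u \<equiv> \<lambda>k a r. cnj (U k $$ (r, a))" and "v \<equiv> \<lambda>j b c. V j $$ (c, b)"
  shows "\<And>k j a b. k \<in> {1..K} \<Longrightarrow> j \<in> {1..K} \<Longrightarrow> k \<noteq> j \<Longrightarrow> a < d k \<Longrightarrow> b < d j \<Longrightarrow>
      (\<Sum>r<N k. \<Sum>c<M j. u k a r * H k j $$ (r, c) * v j b c) = 0"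
    and "\<And>k w. k \<in> {1..K} \<Longrightarrow> (\<forall>r<N k. (\<Sum>a<d k. w a * u k a r) = 0) \<Longrightarrow> \<forall>a<d k. w a = 0"
    and "\<And>j w. j \<in> {1..K} \<Longrightarrow> (\<forall>c<M j. (\<Sum>b<d j. w b * v j b c) = 0) \<Longrightarrow> \<forall>b<d j. w b = 0"
proof -
  have H: "H k j \<in> carrier_mat (N k) (M j)" if "k \<in> {1..K}" "j \<in> {1..K}" for k j
    using carrier that by blast
  have U: "U k \<in> carrier_mat (N k) (d k)" "mat_adjoint (U k) \<in> carrier_mat (d k) (N k)"
    and V: "V k \<in> carrier_mat (M k) (d k)" if "k \<in> {1..K}" for k
    using sol that by (auto simp: IA_solution_def mat_adjoint_carrier)
  have det: "det (mat_adjoint (U k) * H k k * V k) \<noteq> 0" if "k \<in> {1..K}" for k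
  proof -
    have "mat_adjoint (U k) * H k k * V k \<in> carrier_mat (d k) (d k)"
      using U[OF that] V[OF that] H[OF that that] by (intro mult_carrier_mat)
    note vec_space.det_rank_iff[OF this]
    moreover have "vec_space.rank (d k) (mat_adjoint (U k) * H k k * V k) = d k"
      using sol that unfolding IA_solution_def by blast
    ultimately show ?thesis by (simp only:)
  qed
  show "(\<Sum>r<N k. \<Sum>c<M j. u k a r * H k j $$ (r, c) * v j b c) = 0"
    if kj: "k \<in> {1..K}" "j \<in> {1..K}" "k \<noteq> j" and ab: "a < d k" "b < d j" for k j a b
  proof -
    have "(mat_adjoint (U k) * H k j * V j) $$ (a, b) = 0"
      using sol kj ab by (simp add: IA_solution_def)
    then show ?thesis
      using ab mat_adjoint_index[OF U(1)[OF kj(1)] ab(1)]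
      by (simp add: index_mult_mult_mat[OF U(2)[OF kj(1)] H[OF kj(1,2)] V[OF kj(2)] ab] u_def v_def)
  qed
  \<comment> \<open>Transposing the product puts the factor coming from \<open>U k\<close> on the
    right, where independence can be read off.\<close>
  show "\<forall>a<d k. w a = 0" if k: "k \<in> {1..K}" and w: "\<forall>r<N k. (\<Sum>a<d k. w a * u k a r) = 0" for k w
  proof (rule columns_independent_of_det_mult)
    let ?A = "H k k * V k"
    have A: "?A \<in> carrier_mat (N k) (d k)" using H[OF k k] V[OF k] by simp
    show "transpose_mat ?A \<in> carrier_mat (d k) (N k)" using A by simp
    show "transpose_mat (mat_adjoint (U k)) \<in> carrier_mat (N k) (d k)" using U[OF k] by simp
    have "transpose_mat ?A * transpose_mat (mat_adjoint (U k))
        = transpose_mat (mat_adjoint (U k) * H k k * V k)"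
      using transpose_mult[OF U(2)[OF k] A] assoc_mult_mat[OF U(2)[OF k] H[OF k k] V[OF k]] by simp
    then show "det (transpose_mat ?A * transpose_mat (mat_adjoint (U k))) \<noteq> 0"
      using det[OF k] U[OF k] V[OF k] H[OF k k]
      by (metis det_transpose mult_carrier_mat)
    show "\<forall>r<N k. (\<Sum>a<d k. w a * transpose_mat (mat_adjoint (U k)) $$ (r, a)) = 0"
      using w U[OF k] mat_adjoint_index[OF U(1)[OF k]] by (simp add: u_def)
  qed
  show "\<forall>b<d j. w b = 0" if j: "j \<in> {1..K}" and w: "\<forall>c<M j. (\<Sum>b<d j. w b * v j b c) = 0" for j w
  proof (rule columns_independent_of_det_mult[OF _ V[OF j] det[OF j]])
    show "mat_adjoint (U j) * H j j \<in> carrier_mat (d j) (M j)"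
      using U(2)[OF j] H[OF j j] by (rule mult_carrier_mat)
    show "\<forall>c<M j. (\<Sum>b<d j. w b * V j $$ (c, b)) = 0"
      using w unfolding v_def .
  qed
qed

text \<open>By bilinearity the alignment equations persist under column operations on both
  sides.\<close>

lemma sum_normalised_eq_zero:
  fixes u v :: "nat \<Rightarrow> nat \<Rightarrow> 'f :: field"
  assumes "\<And>\<alpha> \<beta>. \<alpha> < p \<Longrightarrow> \<beta> < q \<Longrightarrow> (\<Sum>r<n. \<Sum>c<m. u \<alpha> r * h r c * v \<beta> c) = 0"
  shows "(\<Sum>r<n. \<Sum>c<m. (\<Sum>\<alpha><p. A \<alpha> * u \<alpha> r) * h r c * (\<Sum>\<beta><q. B \<beta> * v \<beta> c)) = 0"
proof -
  have "(\<Sum>r<n. \<Sum>c<m. (\<Sum>\<alpha><p. A \<alpha> * u \<alpha> r) * h r c * (\<Sum>\<beta><q. B \<beta> * v \<beta> c))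
      = (\<Sum>r<n. \<Sum>c<m. \<Sum>\<alpha><p. \<Sum>\<beta><q. A \<alpha> * B \<beta> * (u \<alpha> r * h r c * v \<beta> c))"
    by (simp add: sum_distrib_left sum_distrib_right mult_ac)
  also have "\<dots> = (\<Sum>\<alpha><p. \<Sum>\<beta><q. \<Sum>r<n. \<Sum>c<m. A \<alpha> * B \<beta> * (u \<alpha> r * h r c * v \<beta> c))"
    by (simp only: sum.swap[of _ "{..<p}" "{..<m}"] sum.swap[of _ "{..<p}" "{..<n}"]
        sum.swap[of _ "{..<q}" "{..<m}"] sum.swap[of _ "{..<q}" "{..<n}"])
  also have "\<dots> = 0"
    using assms by (simp add: sum_distrib_left[symmetric])
  finally show ?thesis .
qed

section \<open>Almost sure inequalities for fixed sets of links\<close>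

context
  fixes P :: "'w measure" and K :: nat and M N d :: "nat \<Rightarrow> nat"
    and H :: "nat \<Rightarrow> nat \<Rightarrow> 'w \<Rightarrow> complex mat"
  assumes channels: "random_channels P K M N H"
begin

lemma prob_space_channels: "prob_space P"
  and channel_carrier: "\<And>k j \<omega>. k \<in> {1..K} \<Longrightarrow> j \<in> {1..K} \<Longrightarrow> \<omega> \<in> space P \<Longrightarrow>
      H k j \<omega> \<in> carrier_mat (N k) (M j)"
  and indep_channel_entries: "\<And>Y. Y \<subseteq> entry_indices K M N \<Longrightarrow>
      prob_space.indep_vars P (\<lambda>_. borel) (channel_entry H) Y"
  and channel_entries_continuous: "\<And>i. i \<in> entry_indices K M N \<Longrightarrow>
      continuous_distribution (distr P borel (channel_entry H i))"
  using channels prob_space.indep_vars_subset[of P "\<lambda>_. borel" "channel_entry H" "entry_indices K M N"]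
  by (auto simp: random_channels_def)

text \<open>Whichever of the block matrix and its transpose has at least as many rows as columns is
  generically injective, whence the maximum. When \<open>R\<close> and \<open>T\<close> overlap,
  direct channels are blocks too; they take part in the genericity, while orthogonality concerns
  cross links.\<close>

lemma AE_block_inequality:
  assumes R: "R \<subseteq> {1..K}" and T: "T \<subseteq> {1..K}"
  shows "AE \<omega> in P. IA_solvable K M N d (\<lambda>k j. H k j \<omega>) \<longrightarrow>
    (\<Sum>j\<in>T \<union> R. d j) \<le> max (\<Sum>j\<in>T. M j) (\<Sum>k\<in>R. N k)"
proof -
  let ?A = "Sigma R (\<lambda>k. {..<N k})" and ?B = "Sigma T (\<lambda>j. {..<M j})"
  have fin: "finite R" "finite T" using R T finite_subset by auto
  have finAB: "finite ?A" "finite ?B" using fin by auto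
  define \<iota> :: "nat \<times> nat \<Rightarrow> nat \<times> nat \<Rightarrow> nat \<times> nat \<times> nat \<times> nat" where
    "\<iota> = (\<lambda>(k, r) (j, c). (k, j, r, c))"
  have sub: "case_prod \<iota> ` (?A \<times> ?B) \<subseteq> entry_indices K M N"
    "case_prod (\<lambda>b a. \<iota> a b) ` (?B \<times> ?A) \<subseteq> entry_indices K M N"
    using R T by (auto simp: \<iota>_def entry_indices_def)
  have inj: "inj_on (case_prod \<iota>) (?A \<times> ?B)" "inj_on (case_prod (\<lambda>b a. \<iota> a b)) (?B \<times> ?A)"
    by (auto simp: \<iota>_def inj_on_def)
  have entry: "channel_entry H (\<iota> (k, r) (j, c)) \<omega> = H k j \<omega> $$ (r, c)" for k r j c \<omega>
    by (simp add: \<iota>_def channel_entry_def)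
  show ?thesis
  proof (cases "card ?B \<le> card ?A")
    case True
    have "AE \<omega> in P. \<forall>x. (\<forall>a\<in>?A. (\<Sum>b\<in>?B. channel_entry H (\<iota> a b) \<omega> * x b) = 0)
        \<longrightarrow> (\<forall>b\<in>?B. x b = 0)"
      using sub(1)
      by (intro AE_generic_injective[OF prob_space_channels finAB True inj(1)
            indep_channel_entries[OF sub(1)]] channel_entries_continuous) blast
    with AE_space show ?thesis
    proof eventually_elim
      case (elim \<omega>)
      show ?case
      proof
        assume "IA_solvable K M N d (\<lambda>k j. H k j \<omega>)"
        then obtain U V where sol: "IA_solution K M N d (\<lambda>k j. H k j \<omega>) U V"
          by (auto simp: IA_solvable_def)
        have carrier: "\<forall>k\<in>{1..K}. \<forall>j\<in>{1..K}. H k j \<omega> \<in> carrier_mat (N k) (M j)"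
          using elim(1) by (blast intro: channel_carrier)
        note S = IA_solution_coordinates[OF sol carrier]
        have "(\<Sum>j\<in>T \<union> R. d j) \<le> (\<Sum>k\<in>R. N k)"
        proof (rule block_dimension_bound[where h = "\<lambda>a b. channel_entry H (\<iota> a b) \<omega>" and M = M
              and u = "\<lambda>k a r. cnj (U k $$ (r, a))" and v = "\<lambda>j b c. V j $$ (c, b)", OF fin])
          show "\<forall>b\<in>?B. x b = 0"
            if "\<forall>a\<in>?A. (\<Sum>b\<in>?B. channel_entry H (\<iota> a b) \<omega> * x b) = 0" for x
            using elim(2) that by blast
          show "\<forall>a<d k. w a = 0"
            if "k \<in> R" "\<forall>r<N k. (\<Sum>a<d k. w a * cnj (U k $$ (r, a))) = 0" for k w
            using S(2)[OF _ that(2)] that(1) R by blast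
          show "\<forall>b<d j. w b = 0"
            if "j \<in> T" "\<forall>c<M j. (\<Sum>b<d j. w b * V j $$ (c, b)) = 0" for j w
            using S(3)[OF _ that(2)] that(1) T by blast
          show "(\<Sum>r<N k. \<Sum>c<M j. cnj (U k $$ (r, a)) * channel_entry H (\<iota> (k, r) (j, c)) \<omega>
              * V j $$ (c, b)) = 0"
            if "k \<in> R" "j \<in> T" "k \<noteq> j" "a < d k" "b < d j" for k j a b
            unfolding entry using S(1)[OF _ _ that(3-5)] that(1,2) R T by blast
        qed
        then show "(\<Sum>j\<in>T \<union> R. d j) \<le> max (\<Sum>j\<in>T. M j) (\<Sum>k\<in>R. N k)" by simp
      qed
    qed
  next
    case False
    have "AE \<omega> in P. \<forall>x. (\<forall>b\<in>?B. (\<Sum>a\<in>?A. channel_entry H (\<iota> a b) \<omega> * x a) = 0)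
        \<longrightarrow> (\<forall>a\<in>?A. x a = 0)"
      using sub(2) False
      by (intro AE_generic_injective[OF prob_space_channels finAB(2,1) _ inj(2)
            indep_channel_entries[OF sub(2)]] channel_entries_continuous) (linarith, blast)
    with AE_space show ?thesis
    proof eventually_elim
      case (elim \<omega>)
      show ?case
      proof
        assume "IA_solvable K M N d (\<lambda>k j. H k j \<omega>)"
        then obtain U V where sol: "IA_solution K M N d (\<lambda>k j. H k j \<omega>) U V"
          by (auto simp: IA_solvable_def)
        have carrier: "\<forall>k\<in>{1..K}. \<forall>j\<in>{1..K}. H k j \<omega> \<in> carrier_mat (N k) (M j)"
          using elim(1) by (blast intro: channel_carrier)
        note S = IA_solution_coordinates[OF sol carrier]
        \<comment> \<open>For the transpose the two sides exchange roles: \<open>V\<close> supplies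
          the \<open>u\<close> and the conjugate of \<open>U\<close> supplies the
          \<open>v\<close>.\<close>
        have "(\<Sum>j\<in>R \<union> T. d j) \<le> (\<Sum>k\<in>T. M k)"
        proof (rule block_dimension_bound[where h = "\<lambda>b a. channel_entry H (\<iota> a b) \<omega>" and M = N
              and v = "\<lambda>k a r. cnj (U k $$ (r, a))" and u = "\<lambda>j b c. V j $$ (c, b)", OF fin(2,1)])
          fix k j a b assume "k \<in> T" "j \<in> R" "k \<noteq> j" "a < d k" "b < d j"
          then have "(\<Sum>r<N j. \<Sum>c<M k. cnj (U j $$ (r, b)) * H j k \<omega> $$ (r, c) * V k $$ (c, a)) = 0"
            using S(1)[of j k b a] R T by blast
          then show "(\<Sum>c<M k. \<Sum>r<N j. V k $$ (c, a) * channel_entry H (\<iota> (j, r) (k, c)) \<omega>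
              * cnj (U j $$ (r, b))) = 0"
            by (subst sum.swap) (simp add: entry mult_ac)
        next
          show "\<forall>a\<in>?A. x a = 0"
            if "\<forall>b\<in>?B. (\<Sum>a\<in>?A. channel_entry H (\<iota> a b) \<omega> * x a) = 0" for x
            using elim(2) that by blast
          show "\<forall>a<d k. w a = 0"
            if "k \<in> R" "\<forall>r<N k. (\<Sum>a<d k. w a * cnj (U k $$ (r, a))) = 0" for k w
            using S(2)[OF _ that(2)] that(1) R by blast
          show "\<forall>b<d j. w b = 0"
            if "j \<in> T" "\<forall>c<M j. (\<Sum>b<d j. w b * V j $$ (c, b)) = 0" for j w
            using S(3)[OF _ that(2)] that(1) T by blast
        qed
        then show "(\<Sum>j\<in>T \<union> R. d j) \<le> max (\<Sum>j\<in>T. M j) (\<Sum>k\<in>R. N k)" by (simp add: Un_commute)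
      qed
    qed
  qed
qed

text \<open>The pivot positions depend on the realisation, but only finitely many choices exist. If
  the inequality fails, almost surely none of them admits a normalised solution.\<close>

lemma AE_dimension_inequality:
  assumes J: "J \<subseteq> cross_links K"
  shows "AE \<omega> in P. IA_solvable K M N d (\<lambda>k j. H k j \<omega>) \<longrightarrow>
    (\<Sum>(k, j)\<in>J. d j * d k)
      \<le> (\<Sum>j\<in>tx_set J. d j * (M j - d j)) + (\<Sum>k\<in>rx_set J. d k * (N k - d k))"
proof (cases "(\<Sum>(k, j)\<in>J. d j * d k)
    \<le> (\<Sum>j\<in>tx_set J. d j * (M j - d j)) + (\<Sum>k\<in>rx_set J. d k * (N k - d k))")
  case False
  \<comment> \<open>Injective pivot choices for all users; extensionality keeps the set
    finite.\<close>
  let ?charts = "\<lambda>L. PiE {1..K} (\<lambda>k. PiE {..<d k} (\<lambda>_. {..<L k}) \<inter> {f. inj_on f {..<d k}})"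
  let ?S = "?charts N \<times> ?charts M"
  define normalised where "normalised = (\<lambda>\<sigma> \<rho> \<omega>. \<exists>u v.
    (\<forall>k\<in>rx_set J. \<forall>a<d k. \<forall>a'<d k. u k a (\<sigma> k a') = (if a = a' then 1 else 0)) \<and>
    (\<forall>j\<in>tx_set J. \<forall>b<d j. \<forall>b'<d j. v j b (\<rho> j b') = (if b = b' then 1 else 0)) \<and>
    (\<forall>(k, j)\<in>J. \<forall>a<d k. \<forall>b<d j.
      (\<Sum>r<N k. \<Sum>c<M j. u k a r * channel_entry H (k, j, r, c) \<omega> * v j b c) = 0))"
  have "J \<subseteq> {1..K} \<times> {1..K}" using J by (auto simp: cross_links_def)
  then have finJ: "finite J" by (rule finite_subset) simp
  have RT: "rx_set J \<subseteq> {1..K}" "tx_set J \<subseteq> {1..K}"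
    using J by (auto simp: rx_set_def tx_set_def cross_links_def)
  have sub: "{(k, j, r, c). (k, j) \<in> J \<and> r < N k \<and> c < M j} \<subseteq> entry_indices K M N"
    using J by (auto simp: cross_links_def entry_indices_def)
  have "finite (?charts L)" for L :: "nat \<Rightarrow> nat"
    by (intro finite_PiE finite_Int disjI1) simp_all
  then have "finite ?S" by simp
  then have "AE \<omega> in P. \<forall>s\<in>?S. \<not> normalised (fst s) (snd s) \<omega>"
  proof (rule AE_finite_allI)
    fix s assume s: "s \<in> ?S"
    show "AE \<omega> in P. \<not> normalised (fst s) (snd s) \<omega>"
      unfolding normalised_def
    proof (rule AE_no_normalised_solution[OF prob_space_channels finJ indep_channel_entries[OF sub]])
      show "continuous_distribution (distr P borel (channel_entry H (k, j, r, c)))"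
        if "(k, j) \<in> J" "r < N k" "c < M j" for k j r c
        using that sub by (intro channel_entries_continuous) auto
      show "inj_on (fst s k) {..<d k}" if "k \<in> rx_set J" for k
        using s RT that by (auto simp: PiE_iff)
      show "fst s k a < N k" if "k \<in> rx_set J" "a < d k" for k a
        using s RT that by (fastforce simp: PiE_iff)
      show "inj_on (snd s k) {..<d k}" if "k \<in> tx_set J" for k
        using s RT that by (auto simp: PiE_iff)
      show "snd s k a < M k" if "k \<in> tx_set J" "a < d k" for k a
        using s RT that by (fastforce simp: PiE_iff)
    qed (use False in simp)
  qed
  with AE_space show ?thesis
  proof eventually_elim
    case (elim \<omega>)
    have "False" if "IA_solvable K M N d (\<lambda>k j. H k j \<omega>)"
    proof -
      obtain U V where sol: "IA_solution K M N d (\<lambda>k j. H k j \<omega>) U V"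
        using \<open>IA_solvable _ _ _ _ _\<close> by (auto simp: IA_solvable_def)
      define u where "u = (\<lambda>k a r. cnj (U k $$ (r, a)))"
      define v where "v = (\<lambda>j b c. V j $$ (c, b))"
      have carrier: "\<forall>k\<in>{1..K}. \<forall>j\<in>{1..K}. H k j \<omega> \<in> carrier_mat (N k) (M j)"
          using elim(1) by (blast intro: channel_carrier)
      note S = IA_solution_coordinates[OF sol carrier]
      have u: "\<forall>a<d k. w a = 0"
        if "k \<in> {1..K}" "\<forall>r<N k. (\<Sum>a<d k. w a * u k a r) = 0" for k w
        using S(2)[OF that(1), of w] that(2) unfolding u_def by blast
      have v: "\<forall>b<d j. w b = 0"
        if "j \<in> {1..K}" "\<forall>c<M j. (\<Sum>b<d j. w b * v j b c) = 0" for j w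
        using S(3)[OF that(1), of w] that(2) unfolding v_def by blast
      have orth: "(\<Sum>r<N k. \<Sum>c<M j. u k a r * H k j \<omega> $$ (r, c) * v j b c) = 0"
        if "(k, j) \<in> J" "a < d k" "b < d j" for k j a b
        using S(1)[of k j a b] that J by (auto simp: u_def v_def cross_links_def)
      have "\<forall>k\<in>{1..K}. \<exists>\<sigma> A. (\<forall>a<d k. \<sigma> a < N k) \<and> (\<forall>a<d k. \<forall>a'<d k.
          (\<Sum>\<alpha><d k. A a \<alpha> * u k \<alpha> (\<sigma> a')) = (if a = a' then 1 else 0))"
        using u by (intro ballI ex_normalised_basis)
      then obtain \<sigma> where "\<forall>k\<in>{1..K}. \<exists>A. (\<forall>a<d k. \<sigma> k a < N k) \<and> (\<forall>a<d k. \<forall>a'<d k.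
          (\<Sum>\<alpha><d k. A a \<alpha> * u k \<alpha> (\<sigma> k a')) = (if a = a' then 1 else 0))"
        by (rule bchoice[THEN exE])
      then obtain A where "\<forall>k\<in>{1..K}. (\<forall>a<d k. \<sigma> k a < N k) \<and> (\<forall>a<d k. \<forall>a'<d k.
          (\<Sum>\<alpha><d k. A k a \<alpha> * u k \<alpha> (\<sigma> k a')) = (if a = a' then 1 else 0))"
        by (rule bchoice[THEN exE])
      then have \<sigma>: "\<And>k a. k \<in> {1..K} \<Longrightarrow> a < d k \<Longrightarrow> \<sigma> k a < N k"
        and A: "\<And>k a a'. k \<in> {1..K} \<Longrightarrow> a < d k \<Longrightarrow> a' < d k \<Longrightarrow>
          (\<Sum>\<alpha><d k. A k a \<alpha> * u k \<alpha> (\<sigma> k a')) = (if a = a' then 1 else 0)"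
        by blast+
      have "\<forall>j\<in>{1..K}. \<exists>\<rho> B. (\<forall>b<d j. \<rho> b < M j) \<and> (\<forall>b<d j. \<forall>b'<d j.
          (\<Sum>\<beta><d j. B b \<beta> * v j \<beta> (\<rho> b')) = (if b = b' then 1 else 0))"
        using v by (intro ballI ex_normalised_basis)
      then obtain \<rho> where "\<forall>j\<in>{1..K}. \<exists>B. (\<forall>b<d j. \<rho> j b < M j) \<and> (\<forall>b<d j. \<forall>b'<d j.
          (\<Sum>\<beta><d j. B b \<beta> * v j \<beta> (\<rho> j b')) = (if b = b' then 1 else 0))"
        by (rule bchoice[THEN exE])
      then obtain B where "\<forall>j\<in>{1..K}. (\<forall>b<d j. \<rho> j b < M j) \<and> (\<forall>b<d j. \<forall>b'<d j.
          (\<Sum>\<beta><d j. B j b \<beta> * v j \<beta> (\<rho> j b')) = (if b = b' then 1 else 0))"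
        by (rule bchoice[THEN exE])
      then have \<rho>: "\<And>j b. j \<in> {1..K} \<Longrightarrow> b < d j \<Longrightarrow> \<rho> j b < M j"
        and B: "\<And>j b b'. j \<in> {1..K} \<Longrightarrow> b < d j \<Longrightarrow> b' < d j \<Longrightarrow>
          (\<Sum>\<beta><d j. B j b \<beta> * v j \<beta> (\<rho> j b')) = (if b = b' then 1 else 0)"
        by blast+
      \<comment> \<open>Restriction makes the pivot functions extensional, as \<open>?charts\<close>
        requires.\<close>
      let ?\<sigma> = "\<lambda>k\<in>{1..K}. restrict (\<sigma> k) {..<d k}" and ?\<rho> = "\<lambda>j\<in>{1..K}. restrict (\<rho> j) {..<d j}"
      let ?u = "\<lambda>k a r. \<Sum>\<alpha><d k. A k a \<alpha> * u k \<alpha> r"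
      let ?v = "\<lambda>j b c. \<Sum>\<beta><d j. B j b \<beta> * v j \<beta> c"
      have "inj_on (\<sigma> k) {..<d k}" if "k \<in> {1..K}" for k
        using A[OF that] by (rule kronecker_imp_inj_on)
      moreover have "inj_on (\<rho> j) {..<d j}" if "j \<in> {1..K}" for j
        using B[OF that] by (rule kronecker_imp_inj_on)
      ultimately have mem: "(?\<sigma>, ?\<rho>) \<in> ?S"
        using \<sigma> \<rho> by (auto simp: inj_on_restrict_eq)
      have "normalised ?\<sigma> ?\<rho> \<omega>"
        unfolding normalised_def
      proof (rule exI[of _ ?u], rule exI[of _ ?v], intro conjI)
        show "\<forall>k\<in>rx_set J. \<forall>a<d k. \<forall>a'<d k. ?u k a (?\<sigma> k a') = (if a = a' then 1 else 0)"
          using A RT by (auto simp: subset_iff)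
        show "\<forall>j\<in>tx_set J. \<forall>b<d j. \<forall>b'<d j. ?v j b (?\<rho> j b') = (if b = b' then 1 else 0)"
          using B RT by (auto simp: subset_iff)
        have "(\<Sum>r<N k. \<Sum>c<M j. ?u k a r * channel_entry H (k, j, r, c) \<omega> * ?v j b c) = 0"
          if "(k, j) \<in> J" for k j a b
          unfolding channel_entry_def case_prod_conv
          by (rule sum_normalised_eq_zero) (rule orth[OF that])
        then show "\<forall>(k, j)\<in>J. \<forall>a<d k. \<forall>b<d j.
            (\<Sum>r<N k. \<Sum>c<M j. ?u k a r * channel_entry H (k, j, r, c) \<omega> * ?v j b c) = 0"
          by auto
      qed
      then show False using bspec[OF elim(2) mem] by simp
    qed
    then show ?case by blast
  qed
qed simp

end

theorem mainTheorem1: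
  fixes P :: "'w measure" and K :: nat and M N d :: "nat \<Rightarrow> nat"
    and H :: "nat \<Rightarrow> nat \<Rightarrow> 'w \<Rightarrow> complex mat"
  assumes pos: "\<And>k. k \<in> {1..K} \<Longrightarrow> 0 < M k \<and> 0 < N k \<and> 0 < d k"
    and channels: "random_channels P K M N H"
  shows "AE \<omega> in P. IA_solvable K M N d (\<lambda>k j. H k j \<omega>) \<longrightarrow>
    (\<forall>j\<in>{1..K}. min (M j) (N j) \<ge> d j) \<and>
    (\<forall>J. J \<subseteq> cross_links K \<longrightarrow>
      max (\<Sum>j\<in>tx_set J. M j) (\<Sum>k\<in>rx_set J. N k) \<ge> (\<Sum>j\<in>tx_set J \<union> rx_set J. d j)) \<and>
    (\<forall>J. J \<subseteq> cross_links K \<longrightarrow>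
      (\<Sum>j\<in>tx_set J. int (d j) * (int (M j) - int (d j)))
        + (\<Sum>k\<in>rx_set J. int (d k) * (int (N k) - int (d k)))
      \<ge> (\<Sum>(k, j)\<in>J. int (d j) * int (d k)))"
proof -
  have "cross_links K \<subseteq> {1..K} \<times> {1..K}" by (auto simp: cross_links_def)
  \<comment> \<open>Finitely many \<open>J\<close> occur, so the exceptional null sets can be united
    and the quantifier over \<open>J\<close> moved inside.\<close>
  then have fin: "finite (Pow (cross_links K))" by (simp add: finite_subset)
  have RT: "rx_set J \<subseteq> {1..K}" "tx_set J \<subseteq> {1..K}" if "J \<subseteq> cross_links K" for J
    using that by (auto simp: rx_set_def tx_set_def cross_links_def)
  have "AE \<omega> in P. \<forall>J\<in>Pow (cross_links K). IA_solvable K M N d (\<lambda>k j. H k j \<omega>) \<longrightarrow>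
      (\<Sum>j\<in>tx_set J \<union> rx_set J. d j) \<le> max (\<Sum>j\<in>tx_set J. M j) (\<Sum>k\<in>rx_set J. N k)"
    using RT by (intro AE_finite_allI[OF fin] AE_block_inequality[OF channels]) auto
  moreover have "AE \<omega> in P. \<forall>J\<in>Pow (cross_links K). IA_solvable K M N d (\<lambda>k j. H k j \<omega>) \<longrightarrow>
      (\<Sum>(k, j)\<in>J. d j * d k)
        \<le> (\<Sum>j\<in>tx_set J. d j * (M j - d j)) + (\<Sum>k\<in>rx_set J. d k * (N k - d k))"
    by (intro AE_finite_allI[OF fin] AE_dimension_inequality[OF channels]) auto
  moreover note AE_space
  ultimately show ?thesis
  proof eventually_elim
    case (elim \<omega>)
    show ?case
    proof (rule impI)
      assume solvable: "IA_solvable K M N d (\<lambda>k j. H k j \<omega>)"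
      then obtain U V where sol: "IA_solution K M N d (\<lambda>k j. H k j \<omega>) U V"
        by (auto simp: IA_solvable_def)
      have carrier: "\<forall>k\<in>{1..K}. \<forall>j\<in>{1..K}. H k j \<omega> \<in> carrier_mat (N k) (M j)"
          using elim(3) by (blast intro: channel_carrier[OF channels])
      note S = IA_solution_coordinates[OF sol carrier]
      have le: "d j \<le> M j" "d j \<le> N j" if "j \<in> {1..K}" for j
        using independent_imp_le_dim[OF S(3)[OF that]] independent_imp_le_dim[OF S(2)[OF that]]
        by auto
      have "(\<Sum>(k, j)\<in>J. int (d j) * int (d k))
          \<le> (\<Sum>j\<in>tx_set J. int (d j) * (int (M j) - int (d j)))
            + (\<Sum>k\<in>rx_set J. int (d k) * (int (N k) - int (d k)))"
        if J: "J \<subseteq> cross_links K" for J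
      proof -
        have "int (\<Sum>(k, j)\<in>J. d j * d k) \<le> int ((\<Sum>j\<in>tx_set J. d j * (M j - d j))
            + (\<Sum>k\<in>rx_set J. d k * (N k - d k)))"
          using elim(2) solvable J by (subst of_nat_le_iff) auto
        also have "int (\<Sum>(k, j)\<in>J. d j * d k) = (\<Sum>(k, j)\<in>J. int (d j) * int (d k))"
          by (simp add: case_prod_unfold)
        \<comment> \<open>By \<open>le\<close> the truncated differences of naturals agree with the
          integer ones.\<close>
        also have "int ((\<Sum>j\<in>tx_set J. d j * (M j - d j)) + (\<Sum>k\<in>rx_set J. d k * (N k - d k)))
            = (\<Sum>j\<in>tx_set J. int (d j) * (int (M j) - int (d j)))
            + (\<Sum>k\<in>rx_set J. int (d k) * (int (N k) - int (d k)))"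
          using RT[OF J] le by (simp add: of_nat_diff subset_iff)
        finally show ?thesis .
      qed
      then show "(\<forall>j\<in>{1..K}. min (M j) (N j) \<ge> d j) \<and>
        (\<forall>J. J \<subseteq> cross_links K \<longrightarrow>
          max (\<Sum>j\<in>tx_set J. M j) (\<Sum>k\<in>rx_set J. N k) \<ge> (\<Sum>j\<in>tx_set J \<union> rx_set J. d j)) \<and>
        (\<forall>J. J \<subseteq> cross_links K \<longrightarrow>
          (\<Sum>j\<in>tx_set J. int (d j) * (int (M j) - int (d j)))
            + (\<Sum>k\<in>rx_set J. int (d k) * (int (N k) - int (d k)))
          \<ge> (\<Sum>(k, j)\<in>J. int (d j) * int (d k)))"
        using le elim(1) solvable by auto
    qed
  qed
qed

end
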